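(* Let $f$ be a probability density on $\mathbb{R}$ such that $f\in L^p(\mathbb{R})$ for some $p>1$, $\int_{\mathbb{R}}x^2f(x)\,dx=1$ and $\int_{\mathbb{R}}x^4f(x)\,dx<\infty$. Then there exists a family $\{F_N\}_{N\in\mathbb{N}}$ of symmetric probability densities on the spheres $\mathbb{S}^{N-1}(\sqrt{N})$ that is $f$-chaotic but not entropically chaotic.
   Context: $\mathbb{S}^{N-1}(\sqrt N)\subset\mathbb{R}^N$ is the sphere of radius $\sqrt N$ centered at the origin (Kac's sphere) and $d\sigma^N$ is the uniform probability measure on it. A probability density on $\mathbb{S}^{N-1}(\sqrt N)$ is taken with respect to $d\sigma^N$; it is symmetric if it is invariant under all permutations of the coordinates $v_1,\dots,v_N$. A family $\{F_N\}_{N\in\mathbb{N}}$ of symmetric probability densities on $\mathbb{S}^{N-1}(\sqrt N)$ is $f$-chaotic, where $f$ is a probability density on $\mathbb{R}$, if for every $k\in\mathbb{N}$ the $k$-th marginals $\Pi_k(F_N)$ (the law of $(v_1,\dots,v_k)$ under $F_N\,d\sigma^N$, $N\ge k$) converge as $N\to\infty$ to $f^{\otimes k}(v_1,\dots,v_k)=\prod_{i=1}^k f(v_i)$ weakly, i.e. for every bounded continuous $\phi$ on $\mathbb{R}^k$, $\int_{\mathbb{S}^{N-1}(\sqrt N)}F_N\,\phi(v_1,\dots,v_k)\,d\sigma^N\to\int_{\mathbb{R}^k}f^{\otimes k}\phi\,dv_1\cdots dv_k$. Let $H_N(F_N)=\int_{\mathbb{S}^{N-1}(\sqrt N)}F_N\log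 F_N\,d\sigma^N$, let $\gamma(x)=e^{-x^2/2}/\sqrt{2\pi}$, and let $H(f|\gamma)=\int_{\mathbb{R}}f\log(f/\gamma)\,dx$. The family $\{F_N\}$ is ($f$-)entropically chaotic if it is $f$-chaotic and $\lim_{N\to\infty}H_N(F_N)/N=H(f|\gamma)$. *)

theory Defs
  imports "HOL-Probability.Probability"
begin

text \<open>
  Points of \<open>\<real>\<^sup>N\<close> are the extensional functions in \<^term>\<open>{..<N} \<rightarrow>\<^sub>E (UNIV :: real set)\<close>;
  the coordinates \<open>v\<^sub>1, \<dots>, v\<^sub>N\<close> are \<open>v 0, \<dots>, v (N - 1)\<close>. Only \<open>N \<ge> 1\<close> is meaningful below.
\<close>

definition sq_norm :: "nat \<Rightarrow> (nat \<Rightarrow> real) \<Rightarrow> real" where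
  "sq_norm N v = (\<Sum>i<N. (v i)\<^sup>2)"

definition kac_sphere :: "nat \<Rightarrow> (nat \<Rightarrow> real) set" where
  "kac_sphere N = {v \<in> {..<N} \<rightarrow>\<^sub>E UNIV. sq_norm N v = real N}"

definition punctured_ball :: "nat \<Rightarrow> (nat \<Rightarrow> real) set" where
  "punctured_ball N = {v \<in> {..<N} \<rightarrow>\<^sub>E UNIV. 0 < sq_norm N v \<and> sq_norm N v \<le> real N}"

definition radial_proj :: "nat \<Rightarrow> (nat \<Rightarrow> real) \<Rightarrow> nat \<Rightarrow> real" where
  "radial_proj N v = (\<lambda>i\<in>{..<N}. sqrt (real N) * v i / sqrt (sq_norm N v))"

definition uniform_ball :: "nat \<Rightarrow> (nat \<Rightarrow> real) measure" where
  "uniform_ball N = uniform_measure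
     (restrict_space (\<Pi>\<^sub>M i\<in>{..<N}. lborel) (punctured_ball N)) (punctured_ball N)"

text \<open>
  The uniform probability measure on the sphere, as the normalised cone measure: the mass of
  \<open>A\<close> is the proportion of the ball of radius \<open>\<surd>N\<close> occupied by the cone over \<open>A\<close>. The underlying
  space is the sphere itself with its Borel sets.
\<close>

definition kac_uniform :: "nat \<Rightarrow> (nat \<Rightarrow> real) measure" where
  "kac_uniform N = distr (uniform_ball N)
     (restrict_space (\<Pi>\<^sub>M i\<in>{..<N}. borel) (kac_sphere N)) (radial_proj N)"

lemma space_kac_uniform [simp]: "space (kac_uniform N) = kac_sphere N"
  by (auto simp: kac_uniform_def space_restrict_space space_PiM kac_sphere_def)

lemma measurable_sq_norm [measurable]:
  "sq_norm N \<in> borel_measurable (\<Pi>\<^sub>M i\<in>{..<N}. lborel)"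
  unfolding sq_norm_def by measurable

lemma punctured_ball_sets [measurable]:
  "punctured_ball N \<in> sets (\<Pi>\<^sub>M i\<in>{..<N}. lborel)"
proof -
  have "punctured_ball N = {v \<in> space (\<Pi>\<^sub>M i\<in>{..<N}. lborel). 0 < sq_norm N v \<and> sq_norm N v \<le> real N}"
    by (simp add: punctured_ball_def space_PiM)
  also have "\<dots> \<in> sets (\<Pi>\<^sub>M i\<in>{..<N}. lborel)" by measurable
  finally show ?thesis .
qed

lemma radial_proj_in_kac_sphere:
  assumes "v \<in> punctured_ball N"
  shows "radial_proj N v \<in> kac_sphere N"
proof -
  have pos: "0 < sq_norm N v" using assms by (simp add: punctured_ball_def)
  have "sq_norm N (radial_proj N v) = (\<Sum>i<N. real N / sq_norm N v * (v i)\<^sup>2)"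
    unfolding sq_norm_def[of N "radial_proj N v"] using pos
    by (intro sum.cong) (auto simp: radial_proj_def power_mult_distrib power_divide)
  also have "\<dots> = real N / sq_norm N v * sq_norm N v"
    by (simp only: sum_distrib_left[symmetric] sq_norm_def[symmetric])
  also have "\<dots> = real N" using pos by simp
  finally show ?thesis by (simp add: kac_sphere_def radial_proj_def)
qed

lemma measurable_radial_proj:
  "radial_proj N \<in> measurable (uniform_ball N)
     (restrict_space (\<Pi>\<^sub>M i\<in>{..<N}. borel) (kac_sphere N))"
proof -
  have "radial_proj N \<in> measurable (\<Pi>\<^sub>M i\<in>{..<N}. lborel) (\<Pi>\<^sub>M i\<in>{..<N}. borel)"
    unfolding radial_proj_def by measurable
  then have "radial_proj N \<in> measurable (restrict_space (\<Pi>\<^sub>M i\<in>{..<N}. lborel) (punctured_ball N))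
     (restrict_space (\<Pi>\<^sub>M i\<in>{..<N}. borel) (kac_sphere N))"
    by (intro measurable_restrict_space3) (auto intro: radial_proj_in_kac_sphere)
  then show ?thesis
    by (simp add: uniform_ball_def measurable_def)
qed

lemma prob_space_kac_uniform:
  assumes "N \<ge> 1"
  shows "prob_space (kac_uniform N)"
proof -
  interpret L: product_sigma_finite "\<lambda>_::nat. lborel :: real measure"
    by (simp add: product_sigma_finite_def lborel.sigma_finite_measure_axioms)
  let ?L = "\<Pi>\<^sub>M i\<in>{..<N}. (lborel :: real measure)"
  let ?B = "punctured_ball N"
  have eq: "emeasure ?L ({..<N} \<rightarrow>\<^sub>E {a..b}) = ennreal ((b - a) ^ N)" if "a \<le> b" for a b :: real
    using that by (simp add: L.emeasure_PiM ennreal_power)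
  have "{..<N} \<rightarrow>\<^sub>E {1/2..1} \<subseteq> ?B"
  proof
    fix v assume v: "v \<in> {..<N} \<rightarrow>\<^sub>E {1/2..1::real}"
    have b: "1/2 \<le> v i" "v i \<le> 1" if "i < N" for i
      using v that by (auto simp: PiE_def Pi_def)
    have "0 < sq_norm N v"
      unfolding sq_norm_def
    proof (rule sum_pos)
      show "{..<N} \<noteq> {}" using assms by (metis lessThan_iff empty_iff less_le_trans zero_less_one)
      show "0 < (v i)\<^sup>2" if "i \<in> {..<N}" for i using b(1)[of i] that by simp
    qed simp
    moreover have "sq_norm N v \<le> (\<Sum>i<N. 1)"
      unfolding sq_norm_def
    proof (rule sum_mono)
      show "(v i)\<^sup>2 \<le> 1" if "i \<in> {..<N}" for i
        using b[of i] that by (simp add: power_le_one)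
    qed
    ultimately show "v \<in> ?B" using v by (auto simp: punctured_ball_def PiE_def)
  qed
  then have "emeasure ?L ({..<N} \<rightarrow>\<^sub>E {1/2..1}) \<le> emeasure ?L ?B"
    by (intro emeasure_mono) measurable
  then have nz: "emeasure ?L ?B \<noteq> 0"
    using eq[of "1/2" 1] by auto
  have "?B \<subseteq> {..<N} \<rightarrow>\<^sub>E {- sqrt N..sqrt N}"
  proof
    fix v assume v: "v \<in> ?B"
    have "\<bar>v i\<bar> \<le> sqrt N" if "i < N" for i
    proof -
      have "(v i)\<^sup>2 \<le> sq_norm N v"
        unfolding sq_norm_def using that by (intro member_le_sum) auto
      then have "(v i)\<^sup>2 \<le> real N" using v by (simp add: punctured_ball_def)
      then show ?thesis using real_sqrt_le_mono by fastforce
    qed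
    then show "v \<in> {..<N} \<rightarrow>\<^sub>E {- sqrt N..sqrt N}"
      using v by (auto simp: punctured_ball_def PiE_def Pi_def abs_le_iff minus_le_iff)
  qed
  then have "emeasure ?L ?B \<le> emeasure ?L ({..<N} \<rightarrow>\<^sub>E {- sqrt N..sqrt N})"
    by (intro emeasure_mono sets_PiM_I_finite) auto
  then have fin: "emeasure ?L ?B \<noteq> \<infinity>"
    using eq[of "- sqrt N" "sqrt N"] by (auto simp: top_unique)
  have "prob_space (uniform_ball N)"
    unfolding uniform_ball_def using nz fin
    by (intro prob_space_uniform_measure)
       (simp_all add: emeasure_restrict_space)
  then show ?thesis
    unfolding kac_uniform_def by (intro prob_space.prob_space_distr measurable_radial_proj)
qed

definition is_density :: "'a measure \<Rightarrow> ('a \<Rightarrow> real) \<Rightarrow> bool" where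
  "is_density M f \<longleftrightarrow> f \<in> borel_measurable M \<and> (\<forall>x\<in>space M. 0 \<le> f x) \<and>
     (\<integral>\<^sup>+ x. ennreal (f x) \<partial>M) = 1"

definition symmetric_on_sphere :: "nat \<Rightarrow> ((nat \<Rightarrow> real) \<Rightarrow> real) \<Rightarrow> bool" where
  "symmetric_on_sphere N G \<longleftrightarrow>
     (\<forall>\<pi>. \<pi> permutes {..<N} \<longrightarrow> (\<forall>v\<in>kac_sphere N. G (v \<circ> \<pi>) = G v))"

definition symmetric_density_family :: "(nat \<Rightarrow> (nat \<Rightarrow> real) \<Rightarrow> real) \<Rightarrow> bool" where
  "symmetric_density_family F \<longleftrightarrow>
     (\<forall>N\<ge>1. is_density (kac_uniform N) (F N) \<and> symmetric_on_sphere N (F N))"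

text \<open>
  The topology \<^term>\<open>powertop_real {..<k}\<close> is that of \<open>\<real>\<^sup>k\<close>, with underlying set
  \<^term>\<open>{..<k} \<rightarrow>\<^sub>E (UNIV :: real set)\<close>. Finitely many terms with \<open>N < k\<close>, where there is no
  \<open>k\<close>-th marginal, do not affect the limit.
\<close>

definition chaotic :: "(real \<Rightarrow> real) \<Rightarrow> (nat \<Rightarrow> (nat \<Rightarrow> real) \<Rightarrow> real) \<Rightarrow> bool" where
  "chaotic f F \<longleftrightarrow>
     (\<forall>k\<ge>1. \<forall>\<phi>. continuous_map (powertop_real {..<k}) euclideanreal \<phi> \<longrightarrow>
        bounded (\<phi> ` ({..<k} \<rightarrow>\<^sub>E UNIV)) \<longrightarrow>
        (\<lambda>N. \<integral>v. F N v * \<phi> (restrict v {..<k}) \<partial>kac_uniform N) \<longlonglongrightarrow>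
          (\<integral>x. (\<Prod>i<k. f (x i)) * \<phi> x \<partial>(\<Pi>\<^sub>M i\<in>{..<k}. lborel)))"

text \<open>
  The integral of a real function as an extended real, provided one of the two parts is
  finite. Entropies are taken in this sense because the Bochner integral of a non-integrable
  function is \<open>0\<close>, so that an infinite entropy would be read as \<open>0\<close>. The negative
  parts are always integrable below, since \<open>t ln t \<ge> -1/e\<close>.
\<close>

definition ext_integral :: "'a measure \<Rightarrow> ('a \<Rightarrow> real) \<Rightarrow> ereal" where
  "ext_integral M g =
     enn2ereal (\<integral>\<^sup>+ x. ennreal (g x) \<partial>M) - enn2ereal (\<integral>\<^sup>+ x. ennreal (- g x) \<partial>M)"

definition sphere_entropy :: "nat \<Rightarrow> ((nat \<Rightarrow> real) \<Rightarrow> real) \<Rightarrow> ereal" where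
  "sphere_entropy N G = ext_integral (kac_uniform N) (\<lambda>v. G v * ln (G v))"

definition relative_entropy_gaussian :: "(real \<Rightarrow> real) \<Rightarrow> ereal" where
  "relative_entropy_gaussian f = ext_integral lborel (\<lambda>x. f x * ln (f x / std_normal_density x))"

definition entropically_chaotic ::
    "(real \<Rightarrow> real) \<Rightarrow> (nat \<Rightarrow> (nat \<Rightarrow> real) \<Rightarrow> real) \<Rightarrow> bool" where
  "entropically_chaotic f F \<longleftrightarrow> chaotic f F \<and>
     (\<lambda>N. sphere_entropy N (F N) / ereal (real N)) \<longlonglongrightarrow> relative_entropy_gaussian f"

end

theory Submission
  imports Defs
begin

text \<open>
  Let \<open>G\<^sub>N\<close> be the density of the radial projection to the sphere of \<open>N\<close> independent variables with
  density \<open>f\<close>. It exists by Radon-Nikodym, since the full cone over a null set of the sphere is a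
  Lebesgue null set, and averaging over the permutations makes it symmetric everywhere. By the
  weak law of large numbers the projection is asymptotically the identity on each coordinate, so
  \<open>G\<^sub>N\<close> is \<open>f\<close>-chaotic. Now put a mass \<open>1/N\<close> uniformly on a symmetric set \<open>A\<^sub>N\<close> of measure at most
  \<open>exp (-N\<^sup>3) / N\<close>, a small neighbourhood of \<open>(1, \<dots>, 1)\<close>: the mixture
  \<open>(1 - 1/N) G\<^sub>N + (1/N) 1\<^sub>A / \<sigma>(A)\<close> has the same weak limits, but \<open>A\<^sub>N\<close> alone contributes at least
  \<open>(1/N) ln (exp (N\<^sup>3)) = N\<^sup>2\<close> to its entropy, so the entropy per coordinate tends to infinity,
  whereas \<open>H(f|\<gamma>)\<close> is finite because \<open>f\<close> lies in \<open>L\<^sup>p\<close> and has a second moment.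
\<close>

section \<open>Transformations of finite product measures\<close>

lemma comp_permutes_PiE:
  assumes "\<pi> permutes I" "v \<in> I \<rightarrow>\<^sub>E S"
  shows "v \<circ> \<pi> \<in> I \<rightarrow>\<^sub>E S"
  using assms permutes_in_image[OF assms(1)] by (auto simp: PiE_iff extensional_def permutes_not_in)

lemma measurable_comp_permutes:
  assumes "\<pi> permutes I"
  shows "(\<lambda>v. v \<circ> \<pi>) \<in> measurable (Pi\<^sub>M I (\<lambda>_. M)) (Pi\<^sub>M I (\<lambda>_. M))"
proof -
  have eq: "v \<circ> \<pi> = (\<lambda>i\<in>I. v (\<pi> i))" if "v \<in> space (Pi\<^sub>M I (\<lambda>_. M))" for v
    using that comp_permutes_PiE[OF assms, of v "space M"]
    by (auto simp: space_PiM fun_eq_iff PiE_iff extensional_def restrict_def permutes_not_in[OF assms])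
  have "(\<lambda>v. \<lambda>i\<in>I. v (\<pi> i)) \<in> measurable (Pi\<^sub>M I (\<lambda>_. M)) (Pi\<^sub>M I (\<lambda>_. M))"
    by (intro measurable_restrict measurable_component_singleton) (simp add: permutes_in_image assms)
  then show ?thesis by (subst measurable_cong[OF eq])
qed

text \<open>The preimage of a box is the box with its sides rearranged, and the product of the side
  measures does not see their order. Boxes determine the product measure.\<close>

lemma (in product_sigma_finite) distr_PiM_permutes:
  assumes I: "finite I" and \<pi>: "\<pi> permutes I" and M: "\<And>i. M i = N"
  shows "distr (Pi\<^sub>M I M) (Pi\<^sub>M I M) (\<lambda>v. v \<circ> \<pi>) = Pi\<^sub>M I M"
proof (rule PiM_eqI[OF I])
  fix A assume A: "\<And>i. i \<in> I \<Longrightarrow> A i \<in> sets (M i)"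
  have inv: "inv \<pi> permutes I" using \<pi> by (rule permutes_inv)
  have in_inv: "inv \<pi> i \<in> I" if "i \<in> I" for i using inv that by (simp add: permutes_in_image)
  have "(\<lambda>v. v \<circ> \<pi>) -` Pi\<^sub>E I A \<inter> space (Pi\<^sub>M I M) = Pi\<^sub>E I (A \<circ> inv \<pi>)"
  proof (intro equalityI subsetI)
    fix v assume v: "v \<in> (\<lambda>v. v \<circ> \<pi>) -` Pi\<^sub>E I A \<inter> space (Pi\<^sub>M I M)"
    have "v i \<in> A (inv \<pi> i)" if "i \<in> I" for i
      using v in_inv[OF that] permutes_inverses(1)[OF \<pi>, of i] by (force simp: PiE_iff)
    then show "v \<in> Pi\<^sub>E I (A \<circ> inv \<pi>)" using v by (auto simp: space_PiM PiE_iff)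
  next
    fix v assume v: "v \<in> Pi\<^sub>E I (A \<circ> inv \<pi>)"
    have "A i \<subseteq> space N" if "i \<in> I" for i
      using sets.sets_into_space[OF A[OF that]] by (simp add: M)
    then have sp: "v \<in> I \<rightarrow>\<^sub>E space N"
      using v in_inv by (simp add: PiE_iff) blast
    have "v (\<pi> i) \<in> A i" if "i \<in> I" for i
      using v permutes_inverses(2)[OF \<pi>, of i] permutes_in_image[OF \<pi>, of i] that by (force simp: PiE_iff)
    then show "v \<in> (\<lambda>v. v \<circ> \<pi>) -` Pi\<^sub>E I A \<inter> space (Pi\<^sub>M I M)"
      using comp_permutes_PiE[OF \<pi> sp] sp by (auto simp: space_PiM PiE_iff M)
  qed
  then have "distr (Pi\<^sub>M I M) (Pi\<^sub>M I M) (\<lambda>v. v \<circ> \<pi>) (Pi\<^sub>E I A) = Pi\<^sub>M I M (Pi\<^sub>E I (A \<circ> inv \<pi>))"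
    using A I measurable_comp_permutes[OF \<pi>, of N] unfolding M
    by (subst emeasure_distr) (auto intro!: sets_PiM_I_finite)
  also have "\<dots> = (\<Prod>i\<in>I. emeasure N (A (inv \<pi> i)))"
    using A in_inv I by (subst emeasure_PiM) (auto simp: M)
  also have "\<dots> = (\<Prod>i\<in>I. emeasure N (A i))"
    using prod.permute[OF inv, of "\<lambda>i. emeasure N (A i)"] by (simp add: o_def)
  finally show "distr (Pi\<^sub>M I M) (Pi\<^sub>M I M) (\<lambda>v. v \<circ> \<pi>) (Pi\<^sub>E I A) = (\<Prod>i\<in>I. emeasure (M i) (A i))"
    by (simp add: M)
qed simp

text \<open>The indicator of a box factors over the coordinates, so the integral of the product
  density over a box splits into one-dimensional integrals. Sigma-finiteness of the new factors is a
  hypothesis because a density with infinite values can destroy it.\<close>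

lemma (in product_sigma_finite) PiM_density_eq:
  assumes I: "finite I" and f: "\<And>i. i \<in> I \<Longrightarrow> f i \<in> borel_measurable (M i)"
    and sf: "product_sigma_finite (\<lambda>i. density (M i) (f i))"
  shows "Pi\<^sub>M I (\<lambda>i. density (M i) (f i)) = density (Pi\<^sub>M I M) (\<lambda>x. \<Prod>i\<in>I. f i (x i))"
proof -
  interpret D: product_sigma_finite "\<lambda>i. density (M i) (f i)" by fact
  have [measurable]: "(\<lambda>x. \<Prod>i\<in>I. f i (x i)) \<in> borel_measurable (Pi\<^sub>M I M)"
    using f by measurable
  show ?thesis
  proof (rule D.PiM_eqI[OF I, symmetric])
    show "sets (density (Pi\<^sub>M I M) (\<lambda>x. \<Prod>i\<in>I. f i (x i))) = sets (Pi\<^sub>M I (\<lambda>i. density (M i) (f i)))"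
      by (simp cong: sets_PiM_cong)
    fix A assume A: "\<And>i. i \<in> I \<Longrightarrow> A i \<in> sets (density (M i) (f i))"
    then have A'[measurable]: "Pi\<^sub>E I A \<in> sets (Pi\<^sub>M I M)" by (intro sets_PiM_I_finite I) auto
    have "density (Pi\<^sub>M I M) (\<lambda>x. \<Prod>i\<in>I. f i (x i)) (Pi\<^sub>E I A)
        = (\<integral>\<^sup>+x. (\<Prod>i\<in>I. f i (x i)) * indicator (Pi\<^sub>E I A) x \<partial>Pi\<^sub>M I M)"
      by (intro emeasure_density) measurable
    also have "\<dots> = (\<integral>\<^sup>+x. (\<Prod>i\<in>I. f i (x i) * indicator (A i) (x i)) \<partial>Pi\<^sub>M I M)"
    proof (rule nn_integral_cong)
      fix x assume x: "x \<in> space (Pi\<^sub>M I M)"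
      have "indicator (Pi\<^sub>E I A) x = (\<Prod>i\<in>I. indicator (A i) (x i) :: ennreal)"
        using x I by (auto simp: indicator_def space_PiM PiE_iff prod_zero_iff)
      then show "(\<Prod>i\<in>I. f i (x i)) * indicator (Pi\<^sub>E I A) x = (\<Prod>i\<in>I. f i (x i) * indicator (A i) (x i))"
        by (simp add: prod.distrib)
    qed
    also have "\<dots> = (\<Prod>i\<in>I. \<integral>\<^sup>+x. f i x * indicator (A i) x \<partial>M i)"
      using A f by (intro product_nn_integral_prod I) auto
    also have "\<dots> = (\<Prod>i\<in>I. density (M i) (f i) (A i))"
      using A f by (intro prod.cong refl emeasure_density[symmetric]) auto
    finally show "density (Pi\<^sub>M I M) (\<lambda>x. \<Prod>i\<in>I. f i (x i)) (Pi\<^sub>E I A) = \<dots>" .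
  qed
qed

lemma product_sigma_finite_lborel: "product_sigma_finite (\<lambda>_. lborel :: real measure)"
  by (simp add: product_sigma_finite_def lborel.sigma_finite_measure_axioms)

text \<open>Each coordinate contributes one factor \<open>inverse c\<close>. In
  \<open>null_full_cone\<close> this carries null sets inside the ball to null sets at any distance
  from the origin.\<close>

lemma emeasure_PiM_lborel_scale:
  fixes I :: "'i set"
  assumes I: "finite I" and c: "c > 0" and Z: "Z \<in> sets (Pi\<^sub>M I (\<lambda>_. lborel :: real measure))"
  shows "emeasure (Pi\<^sub>M I (\<lambda>_. lborel)) {v \<in> I \<rightarrow>\<^sub>E UNIV. (\<lambda>i\<in>I. c * v i) \<in> Z}
    = ennreal (inverse c) ^ card I * emeasure (Pi\<^sub>M I (\<lambda>_. lborel)) Z"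
proof -
  interpret product_sigma_finite "\<lambda>_::'i. lborel :: real measure" by (rule product_sigma_finite_lborel)
  let ?L = "Pi\<^sub>M I (\<lambda>_. lborel :: real measure)" and ?s = "\<lambda>v. \<lambda>i\<in>I. c * v i"
  have s[measurable]: "?s \<in> measurable ?L ?L" by measurable
  have cc: "ennreal c * (ennreal (inverse c) * x) = x" for x
    using c by (simp add: mult.assoc[symmetric] ennreal_mult[symmetric])
  \<comment> \<open>Scaling divides the mass of every set by \<open>c ^ card I\<close>, so
    reweighting the image by that constant must return Lebesgue measure; boxes suffice to see
    this.\<close>
  have "density (distr ?L ?L ?s) (\<lambda>_. ennreal c ^ card I) = ?L"
  proof (rule PiM_eqI[OF I])
    fix A :: "'i \<Rightarrow> real set" assume A: "\<And>i. i \<in> I \<Longrightarrow> A i \<in> sets lborel"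
    have A': "Pi\<^sub>E I A \<in> sets ?L" by (intro sets_PiM_I_finite I A)
    have pre: "?s -` Pi\<^sub>E I A \<inter> space ?L = Pi\<^sub>E I (\<lambda>i. ((*) c) -` A i)"
      by (auto simp: space_PiM PiE_iff)
    have 1: "emeasure lborel ((*) c -` A i) = ennreal (inverse c) * emeasure lborel (A i)" if "i \<in> I" for i
    proof -
      have "emeasure lborel ((*) c -` A i) = emeasure (distr lborel borel ((*) c)) (A i)"
        using A[OF that] by (subst emeasure_distr) auto
      also have "\<dots> = emeasure (density lborel (\<lambda>_. ennreal (inverse \<bar>c\<bar>))) (A i)"
        using c by (simp add: lborel_distr_mult)
      also have "\<dots> = ennreal (inverse c) * emeasure lborel (A i)"
        using A[OF that] c by (subst emeasure_density_const) auto
      finally show ?thesis .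
    qed
    have "emeasure (density (distr ?L ?L ?s) (\<lambda>_. ennreal c ^ card I)) (Pi\<^sub>E I A)
      = ennreal c ^ card I * emeasure ?L (Pi\<^sub>E I (\<lambda>i. ((*) c) -` A i))"
      using A' by (subst emeasure_density_const) (auto simp: emeasure_distr pre)
    also have "emeasure ?L (Pi\<^sub>E I (\<lambda>i. ((*) c) -` A i)) = (\<Prod>i\<in>I. ennreal (inverse c) * emeasure lborel (A i))"
      using A I by (subst emeasure_PiM) (auto intro!: prod.cong 1 measurable_sets_borel[of _ borel])
    also have "ennreal c ^ card I * \<dots> = (\<Prod>i\<in>I. ennreal c * (ennreal (inverse c) * emeasure lborel (A i)))"
      by (simp only: prod.distrib prod_constant)
    finally show "emeasure (density (distr ?L ?L ?s) (\<lambda>_. ennreal c ^ card I)) (Pi\<^sub>E I A) = (\<Prod>i\<in>I. emeasure lborel (A i))"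
      by (simp only: cc)
  qed simp
  then have "emeasure ?L Z = emeasure (density (distr ?L ?L ?s) (\<lambda>_. ennreal c ^ card I)) Z" by simp
  also have "\<dots> = ennreal c ^ card I * emeasure (distr ?L ?L ?s) Z"
    using Z by (subst emeasure_density_const) auto
  also have "emeasure (distr ?L ?L ?s) Z = emeasure ?L {v \<in> I \<rightarrow>\<^sub>E UNIV. ?s v \<in> Z}"
    using Z by (subst emeasure_distr) (auto simp: space_PiM intro!: arg_cong[where f="emeasure ?L"])
  finally have *: "emeasure ?L Z = ennreal c ^ card I * emeasure ?L {v \<in> I \<rightarrow>\<^sub>E UNIV. ?s v \<in> Z}" .
  have "ennreal (inverse c) ^ card I * (ennreal c ^ card I * x) = x" for x
    using c by (simp add: mult.assoc[symmetric] ennreal_mult[symmetric] power_mult_distrib[symmetric])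
  then show ?thesis using * by simp
qed

section \<open>Cones and the uniform measure on the sphere\<close>

lemma sets_kac_uniform:
  "sets (kac_uniform N) = sets (restrict_space (\<Pi>\<^sub>M i\<in>{..<N}. borel) (kac_sphere N))"
  by (simp add: kac_uniform_def)

lemma sq_norm_measurable_borel [measurable]:
  "sq_norm N \<in> borel_measurable (\<Pi>\<^sub>M i\<in>{..<N}. borel)"
  unfolding sq_norm_def by measurable

lemma sq_norm_permutes:
  assumes "\<pi> permutes {..<N}"
  shows "sq_norm N (v \<circ> \<pi>) = sq_norm N v"
  using sum.permute[OF assms, of "\<lambda>i. (v i)\<^sup>2"] by (simp add: sq_norm_def o_def)

lemma radial_proj_permutes:
  assumes "\<pi> permutes {..<N}"
  shows "radial_proj N (v \<circ> \<pi>) = radial_proj N v \<circ> \<pi>"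
  using permutes_in_image[OF assms] permutes_not_in[OF assms]
  by (auto simp: radial_proj_def sq_norm_permutes[OF assms] fun_eq_iff)

lemma kac_sphere_permutes:
  assumes "\<pi> permutes {..<N}" "v \<in> kac_sphere N"
  shows "v \<circ> \<pi> \<in> kac_sphere N"
  using assms comp_permutes_PiE[OF assms(1), of v UNIV] by (simp add: kac_sphere_def sq_norm_permutes)

lemma measurable_kac_uniform_permutes:
  assumes "\<pi> permutes {..<N}"
  shows "(\<lambda>v. v \<circ> \<pi>) \<in> measurable (kac_uniform N) (kac_uniform N)"
proof -
  have "(\<lambda>v. v \<circ> \<pi>) \<in> measurable (restrict_space (\<Pi>\<^sub>M i\<in>{..<N}. borel) (kac_sphere N))
     (restrict_space (\<Pi>\<^sub>M i\<in>{..<N}. borel) (kac_sphere N))"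
    by (intro measurable_restrict_space3 measurable_comp_permutes assms)
       (auto intro: kac_sphere_permutes assms)
  then show ?thesis by (simp cong: measurable_cong_sets add: sets_kac_uniform)
qed

text \<open>The truncated cone over \<open>A\<close>: its share of the volume of the ball is the
  uniform mass of \<open>A\<close>, which reduces questions on the sphere to Lebesgue
  measure.\<close>

definition cone_ball :: "nat \<Rightarrow> (nat \<Rightarrow> real) set \<Rightarrow> (nat \<Rightarrow> real) set" where
  "cone_ball N A = {v \<in> punctured_ball N. radial_proj N v \<in> A}"

lemma cone_ball_sets:
  assumes "A \<in> sets (kac_uniform N)"
  shows "cone_ball N A \<in> sets (\<Pi>\<^sub>M i\<in>{..<N}. lborel)"
proof -
  have "radial_proj N -` A \<inter> space (uniform_ball N) \<in> sets (uniform_ball N)"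
    using assms by (intro measurable_sets[OF measurable_radial_proj]) (simp add: sets_kac_uniform)
  moreover have "radial_proj N -` A \<inter> space (uniform_ball N) = cone_ball N A"
    by (auto simp: cone_ball_def uniform_ball_def space_restrict_space punctured_ball_def space_PiM)
  ultimately have "cone_ball N A \<in> sets (restrict_space (\<Pi>\<^sub>M i\<in>{..<N}. lborel) (punctured_ball N))"
    by (simp add: uniform_ball_def)
  then show ?thesis
    by (subst (asm) sets_restrict_space_iff) auto
qed

lemma emeasure_kac_uniform:
  assumes A: "A \<in> sets (kac_uniform N)"
  shows "emeasure (kac_uniform N) A =
    emeasure (\<Pi>\<^sub>M i\<in>{..<N}. lborel) (cone_ball N A) /
    emeasure (\<Pi>\<^sub>M i\<in>{..<N}. lborel) (punctured_ball N)"
proof -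
  let ?L = "\<Pi>\<^sub>M i\<in>{..<N}. lborel :: real measure"
  let ?R = "restrict_space ?L (punctured_ball N)"
  have B: "punctured_ball N \<in> sets ?R"
    by (subst sets_restrict_space_iff) auto
  have C: "cone_ball N A \<in> sets ?R"
    using cone_ball_sets[OF A] by (subst sets_restrict_space_iff) (auto simp: cone_ball_def)
  have "emeasure (kac_uniform N) A = emeasure (uniform_ball N) (cone_ball N A)"
    unfolding kac_uniform_def using A
    by (subst emeasure_distr[OF measurable_radial_proj])
       (auto simp: sets_kac_uniform cone_ball_def uniform_ball_def space_restrict_space punctured_ball_def
          space_PiM intro!: arg_cong2[where f=emeasure])
  also have "\<dots> = emeasure ?R (cone_ball N A) / emeasure ?R (punctured_ball N)"
    unfolding uniform_ball_def using B C
    by (subst emeasure_uniform_measure) (auto simp: cone_ball_def intro!: arg_cong2[where f="(/)"] arg_cong2[where f=emeasure])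
  also have "\<dots> = emeasure ?L (cone_ball N A) / emeasure ?L (punctured_ball N)"
    by (subst (1 2) emeasure_restrict_space) (auto simp: cone_ball_def)
  finally show ?thesis .
qed

text \<open>The cone over the whole sphere is the punctured ball, and the sphere has mass 1. Hence
  this volume divided by itself is 1, which in \<open>ennreal\<close> excludes both 0 and
  infinity.\<close>

lemma emeasure_punctured_ball:
  assumes "N \<ge> 1"
  shows "emeasure (\<Pi>\<^sub>M i\<in>{..<N}. lborel) (punctured_ball N) \<noteq> 0"
    and "emeasure (\<Pi>\<^sub>M i\<in>{..<N}. lborel) (punctured_ball N) \<noteq> \<infinity>"
proof -
  interpret prob_space "kac_uniform N" by (rule prob_space_kac_uniform[OF assms])
  have "cone_ball N (kac_sphere N) = punctured_ball N"
    by (auto simp: cone_ball_def radial_proj_in_kac_sphere)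
  then have 1: "1 = emeasure (\<Pi>\<^sub>M i\<in>{..<N}. lborel) (punctured_ball N) /
     emeasure (\<Pi>\<^sub>M i\<in>{..<N}. lborel) (punctured_ball N)"
    using emeasure_kac_uniform[of "kac_sphere N" N] emeasure_space_1 sets.top[of "kac_uniform N"] by simp
  show "emeasure (\<Pi>\<^sub>M i\<in>{..<N}. lborel) (punctured_ball N) \<noteq> 0" using 1 by auto
  show "emeasure (\<Pi>\<^sub>M i\<in>{..<N}. lborel) (punctured_ball N) \<noteq> \<infinity>"
  proof
    assume "emeasure (\<Pi>\<^sub>M i\<in>{..<N}. lborel) (punctured_ball N) = \<infinity>"
    with 1 show False by simp
  qed
qed

lemma emeasure_kac_uniform_eq_0_iff:
  assumes "N \<ge> 1" "A \<in> sets (kac_uniform N)"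
  shows "emeasure (kac_uniform N) A = 0 \<longleftrightarrow> emeasure (\<Pi>\<^sub>M i\<in>{..<N}. lborel) (cone_ball N A) = 0"
  using emeasure_punctured_ball[OF assms(1)] emeasure_kac_uniform[OF assms(2)]
  by (auto simp: ennreal_divide_eq_0_iff)

text \<open>The ball is invariant under permutations and the radial projection commutes with them,
  so the cone over a preimage is the preimage of the cone; Lebesgue measure is invariant.\<close>

lemma distr_kac_uniform_permutes:
  assumes \<pi>: "\<pi> permutes {..<N}"
  shows "distr (kac_uniform N) (kac_uniform N) (\<lambda>v. v \<circ> \<pi>) = kac_uniform N"
proof (rule measure_eqI)
  interpret L: product_sigma_finite "\<lambda>_::nat. lborel :: real measure" by (rule product_sigma_finite_lborel)
  let ?L = "\<Pi>\<^sub>M i\<in>{..<N}. lborel :: real measure"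
  fix A assume "A \<in> sets (distr (kac_uniform N) (kac_uniform N) (\<lambda>v. v \<circ> \<pi>))"
  then have A: "A \<in> sets (kac_uniform N)" by simp
  let ?A = "{v \<in> kac_sphere N. v \<circ> \<pi> \<in> A}"
  have eq: "(\<lambda>v. v \<circ> \<pi>) -` A \<inter> space (kac_uniform N) = ?A" by auto
  have A': "?A \<in> sets (kac_uniform N)"
    using measurable_sets[OF measurable_kac_uniform_permutes[OF \<pi>] A] by (simp only: eq)
  have mem: "v \<in> cone_ball N ?A \<longleftrightarrow> v \<in> (\<lambda>v. v \<circ> \<pi>) -` cone_ball N A \<inter> space ?L" for v
    using radial_proj_in_kac_sphere[of v N] comp_permutes_PiE[OF \<pi>, of v UNIV]
    by (auto simp: cone_ball_def space_PiM radial_proj_permutes[OF \<pi>] punctured_ball_def sq_norm_permutes[OF \<pi>])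
  have "emeasure ?L (cone_ball N ?A) = emeasure (distr ?L ?L (\<lambda>v. v \<circ> \<pi>)) (cone_ball N A)"
    using cone_ball_sets[OF A] mem
    by (subst emeasure_distr[OF measurable_comp_permutes[OF \<pi>]]) (auto intro!: arg_cong[where f="emeasure ?L"])
  also have "\<dots> = emeasure ?L (cone_ball N A)"
    using L.distr_PiM_permutes[OF _ \<pi>, of lborel] by simp
  finally have "emeasure (kac_uniform N) ?A = emeasure (kac_uniform N) A"
    by (simp add: emeasure_kac_uniform A A')
  then show "emeasure (distr (kac_uniform N) (kac_uniform N) (\<lambda>v. v \<circ> \<pi>)) A = emeasure (kac_uniform N) A"
    by (simp only: emeasure_distr[OF measurable_kac_uniform_permutes[OF \<pi>] A] eq)
qed simp

text \<open>The value at the origin is arbitrary.\<close>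
definition sphere_proj :: "nat \<Rightarrow> (nat \<Rightarrow> real) \<Rightarrow> nat \<Rightarrow> real" where
  "sphere_proj N v = (if 0 < sq_norm N v then radial_proj N v else (\<lambda>i\<in>{..<N}. 1))"

lemma sphere_proj_in_kac_sphere: "sphere_proj N v \<in> kac_sphere N"
proof (cases "0 < sq_norm N v")
  case True
  have "sq_norm N (radial_proj N v) = (\<Sum>i<N. real N / sq_norm N v * (v i)\<^sup>2)"
    unfolding sq_norm_def[of N "radial_proj N v"] using True
    by (intro sum.cong) (auto simp: radial_proj_def power_mult_distrib power_divide)
  also have "\<dots> = real N / sq_norm N v * sq_norm N v"
    by (simp only: sum_distrib_left[symmetric] sq_norm_def[symmetric])
  also have "\<dots> = real N" using True by simp
  finally show ?thesis using True by (simp add: sphere_proj_def kac_sphere_def radial_proj_def)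
next
  case False
  \<comment> \<open>The constant vector 1 has squared norm \<open>N\<close>, so the default value is
    a point of the sphere. It is also fixed by permutations, as \<open>sphere_proj_permutes\<close>
    requires.\<close>
  then show ?thesis by (simp add: sphere_proj_def kac_sphere_def sq_norm_def)
qed

lemma sphere_proj_permutes:
  assumes "\<pi> permutes {..<N}"
  shows "sphere_proj N (v \<circ> \<pi>) = sphere_proj N v \<circ> \<pi>"
  using permutes_in_image[OF assms] permutes_not_in[OF assms]
  by (auto simp: sphere_proj_def sq_norm_permutes[OF assms] radial_proj_permutes[OF assms] fun_eq_iff)

lemma sphere_proj_restrict: "sphere_proj N (restrict v {..<N}) = sphere_proj N v"
  by (auto simp: sphere_proj_def radial_proj_def sq_norm_def fun_eq_iff)

lemma measurable_sphere_proj: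
  "sphere_proj N \<in> measurable (\<Pi>\<^sub>M i\<in>{..<N}. borel) (kac_uniform N)"
proof -
  have [measurable]: "radial_proj N \<in> measurable (\<Pi>\<^sub>M i\<in>{..<N}. borel) (\<Pi>\<^sub>M i\<in>{..<N}. borel)"
    unfolding radial_proj_def by measurable
  have "(\<lambda>i\<in>{..<N}. 1) \<in> space (\<Pi>\<^sub>M i\<in>{..<N}. borel :: real measure)" by (simp add: space_PiM)
  then have "sphere_proj N \<in> measurable (\<Pi>\<^sub>M i\<in>{..<N}. borel) (\<Pi>\<^sub>M i\<in>{..<N}. borel)"
    unfolding sphere_proj_def by measurable
  then have "sphere_proj N \<in> measurable (\<Pi>\<^sub>M i\<in>{..<N}. borel) (restrict_space (\<Pi>\<^sub>M i\<in>{..<N}. borel) (kac_sphere N))"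
    by (intro measurable_restrict_space2) (auto simp: sphere_proj_in_kac_sphere)
  then show ?thesis by (simp cong: measurable_cong_sets add: sets_kac_uniform)
qed

text \<open>The uniform measure only controls cones inside the ball. A nonzero vector enters the
  ball after division by a large \<open>n + 1\<close>, with unchanged radial projection, so the bad
  vectors lie in countably many dilated null cones together with the origin.\<close>

lemma null_full_cone:
  assumes N: "N \<ge> 1" and A: "A \<in> sets (kac_uniform N)" and null: "emeasure (kac_uniform N) A = 0"
  shows "AE v in \<Pi>\<^sub>M i\<in>{..<N}. lborel. sphere_proj N v \<notin> A"
proof -
  interpret L: product_sigma_finite "\<lambda>_::nat. lborel :: real measure" by (rule product_sigma_finite_lborel)
  let ?L = "\<Pi>\<^sub>M i\<in>{..<N}. lborel :: real measure"
  let ?s = "\<lambda>n v. \<lambda>i\<in>{..<N}. inverse (real (Suc n)) * v i"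
  have "{v \<in> {..<N} \<rightarrow>\<^sub>E UNIV. ?s n v \<in> cone_ball N A} \<in> null_sets ?L" for n
  proof (rule null_setsI)
    have "?s n \<in> measurable ?L ?L" by measurable
    from measurable_sets[OF this cone_ball_sets[OF A]]
    show "{v \<in> {..<N} \<rightarrow>\<^sub>E UNIV. ?s n v \<in> cone_ball N A} \<in> sets ?L"
      by (simp add: vimage_def Int_def space_PiM conj_commute)
    show "emeasure ?L {v \<in> {..<N} \<rightarrow>\<^sub>E UNIV. ?s n v \<in> cone_ball N A} = 0"
      using null by (subst emeasure_PiM_lborel_scale) (auto simp: emeasure_kac_uniform_eq_0_iff[OF N A] cone_ball_sets[OF A])
  qed
  then have "AE v in ?L. v \<notin> {v \<in> {..<N} \<rightarrow>\<^sub>E UNIV. ?s n v \<in> cone_ball N A}" for n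
    by (rule AE_not_in)
  then have 1: "AE v in ?L. \<forall>n. v \<notin> {v \<in> {..<N} \<rightarrow>\<^sub>E UNIV. ?s n v \<in> cone_ball N A}"
    unfolding AE_all_countable by blast
  \<comment> \<open>The origin is a box with \<open>N\<close> sides of measure 0. Here
    \<open>N \<ge> 1\<close> matters, since an empty product would be 1.\<close>
  have "emeasure ?L ({..<N} \<rightarrow>\<^sub>E {0}) = (\<Prod>i<N. emeasure lborel {0::real})"
    by (rule L.emeasure_PiM) auto
  then have "({..<N} \<rightarrow>\<^sub>E {0}) \<in> null_sets ?L"
    using N by (intro null_setsI sets_PiM_I_finite) (simp_all add: power_0_left)
  then have 2: "AE v in ?L. v \<notin> {..<N} \<rightarrow>\<^sub>E {0}" by (rule AE_not_in)
  show ?thesis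
    using 1 2 AE_space
  proof eventually_elim
    case (elim v)
    have sp: "v \<in> {..<N} \<rightarrow>\<^sub>E UNIV" using elim by (simp add: space_PiM)
    have pos: "0 < sq_norm N v"
    proof (rule ccontr)
      assume "\<not> 0 < sq_norm N v"
      then have "sq_norm N v = 0" using sum_nonneg[of "{..<N}" "\<lambda>i. (v i)\<^sup>2"] by (simp add: sq_norm_def)
      then have "\<forall>i<N. v i = 0" by (simp add: sq_norm_def sum_nonneg_eq_0_iff)
      then have "v \<in> {..<N} \<rightarrow>\<^sub>E {0}" using sp by (auto simp: PiE_iff fun_eq_iff extensional_def)
      then show False using elim(2) by contradiction
    qed
    \<comment> \<open>Any \<open>n\<close> above the squared norm will do, because
      \<open>n / (n + 1)^2 \<le> 1 \<le> N\<close>.\<close>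
    obtain n where n: "sq_norm N v < real n" using reals_Archimedean2 by blast
    have "sq_norm N (?s n v) = (inverse (real (Suc n)))\<^sup>2 * sq_norm N v"
      by (simp only: sq_norm_def sum_distrib_left) (auto simp: power_mult_distrib intro!: sum.cong)
    then have sq: "sq_norm N (?s n v) = sq_norm N v / (real (Suc n))\<^sup>2"
      by (simp only: power_inverse divide_inverse mult.commute)
    have "real n \<le> real (Suc n) ^ 2 * real N"
    proof -
      have "real n \<le> real (Suc n) * 1" by simp
      also have "\<dots> \<le> real (Suc n) ^ 2 * real N"
        unfolding power2_eq_square using N by (intro mult_mono) auto
      finally show ?thesis .
    qed
    then have "sq_norm N v \<le> real N * real (Suc n) ^ 2" using n by (simp only: mult.commute)
    then have le: "sq_norm N (?s n v) \<le> real N"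
      unfolding sq by (subst pos_divide_le_eq) simp_all
    have pos': "0 < sq_norm N (?s n v)" unfolding sq using pos by (intro divide_pos_pos) simp_all
    have root: "sqrt (sq_norm N (?s n v)) = sqrt (sq_norm N v) / real (Suc n)"
      unfolding sq real_sqrt_divide by (simp only: real_sqrt_abs abs_of_nat)
    have cancel: "a * (inverse m * b) / (q / m) = a * b / q" if "m > 0" "q > 0" for a b m q :: real
      using that by (simp add: field_simps)
    have "radial_proj N (?s n v) = radial_proj N v"
    proof (rule ext)
      show "radial_proj N (?s n v) i = radial_proj N v i" for i
      proof (cases "i < N")
        case True
        then show ?thesis
          unfolding radial_proj_def root using pos by (simp only: restrict_apply' lessThan_iff cancel
            real_sqrt_gt_0_iff of_nat_0_less_iff zero_less_Suc)
      qed (simp add: radial_proj_def)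
    qed
    moreover have "?s n v \<in> punctured_ball N" using le pos' by (simp add: punctured_ball_def)
    moreover have "?s n v \<notin> cone_ball N A" using elim(1) sp by blast
    ultimately show ?case using pos by (simp add: cone_ball_def sphere_proj_def)
  qed
qed

section \<open>Densities of projected product laws\<close>

text \<open>A Radon-Nikodym derivative of an invariant law is symmetric only almost everywhere.
  Averaging it over the finite group of permutations makes it symmetric at every point, and
  invariance of both measures keeps it a density of \<open>Q\<close>.\<close>

lemma exists_symmetric_density:
  assumes N: "N \<ge> 1" and Q: "prob_space Q" and sets_Q: "sets Q = sets (kac_uniform N)"
    and ac: "absolutely_continuous (kac_uniform N) Q"
    and inv: "\<And>\<pi>. \<pi> permutes {..<N} \<Longrightarrow> distr Q Q (\<lambda>v. v \<circ> \<pi>) = Q"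
  obtains G where "is_density (kac_uniform N) G" "symmetric_on_sphere N G"
    "density (kac_uniform N) (\<lambda>v. ennreal (G v)) = Q"
proof -
  let ?K = "kac_uniform N" and ?P = "{\<pi>. \<pi> permutes {..<N}}"
  interpret K: prob_space ?K by (rule prob_space_kac_uniform[OF N])
  interpret Q: prob_space Q by fact
  obtain D where D[measurable]: "D \<in> borel_measurable ?K"
      and RN: "AE v in ?K. RN_deriv ?K Q v = ennreal (D v)" and D_nonneg: "\<And>v. 0 \<le> D v"
    using K.real_RN_deriv[OF Q.finite_measure_axioms ac sets_Q] by metis
  have dens_D: "density ?K (\<lambda>v. ennreal (D v)) = Q"
    using K.density_RN_deriv[OF ac sets_Q] density_cong[OF _ _ RN] by simp
  have fin: "finite ?P" by (simp add: finite_permutations)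
  have card: "card ?P > 0"
    using fin by (simp add: card_gt_0_iff) (blast intro: permutes_id)
  define G where "G v = (\<Sum>\<pi>\<in>?P. D (v \<circ> \<pi>)) / real (card ?P)" for v
  note perm_meas = measurable_kac_uniform_permutes
  have D_perm: "(\<lambda>v. D (v \<circ> \<pi>)) \<in> borel_measurable ?K" if "\<pi> permutes {..<N}" for \<pi>
    using measurable_compose[OF perm_meas[OF that] D] .
  have G[measurable]: "G \<in> borel_measurable ?K"
    unfolding G_def[abs_def] using D_perm by (intro borel_measurable_divide borel_measurable_sum) auto
  have G_nonneg: "0 \<le> G v" for v
    unfolding G_def by (intro divide_nonneg_nonneg sum_nonneg D_nonneg) auto
  have dens_G: "density ?K (\<lambda>v. ennreal (G v)) = Q"
  proof (rule measure_eqI)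
    fix A assume "A \<in> sets (density ?K (\<lambda>v. ennreal (G v)))"
    then have A[measurable]: "A \<in> sets ?K" by simp
    \<comment> \<open>Substituting \<open>w = v \<circ> \<pi>\<close> moves the permutation from
      \<open>D\<close> to the test set, by invariance of the uniform measure. Invariance of
      \<open>Q\<close> under \<open>inv \<pi>\<close> then removes it.\<close>
    have summand: "(\<integral>\<^sup>+v. ennreal (D (v \<circ> \<pi>)) * indicator A v \<partial>?K) = emeasure Q A" if "\<pi> permutes {..<N}" for \<pi>
    proof -
      have inv\<pi>: "inv \<pi> permutes {..<N}" using that by (rule permutes_inv)
      have ind: "(\<lambda>w. indicator A (w \<circ> inv \<pi>) :: ennreal) \<in> borel_measurable ?K"
        using measurable_compose[OF perm_meas[OF inv\<pi>], of "indicator A :: _ \<Rightarrow> ennreal" borel] by simp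
      have "(\<integral>\<^sup>+v. ennreal (D (v \<circ> \<pi>)) * indicator A v \<partial>?K)
          = (\<integral>\<^sup>+v. ennreal (D (v \<circ> \<pi>)) * indicator A ((v \<circ> \<pi>) \<circ> inv \<pi>) \<partial>?K)"
        using permutes_inv_o(1)[OF that] by (simp add: o_assoc[symmetric])
      also have "\<dots> = (\<integral>\<^sup>+w. ennreal (D w) * indicator A (w \<circ> inv \<pi>) \<partial>distr ?K ?K (\<lambda>v. v \<circ> \<pi>))"
        using ind by (subst nn_integral_distr[OF perm_meas[OF that]]) auto
      also have "\<dots> = (\<integral>\<^sup>+w. indicator A (w \<circ> inv \<pi>) \<partial>Q)"
        unfolding distr_kac_uniform_permutes[OF that] dens_D[symmetric]
        using ind by (subst nn_integral_density) auto
      also have "\<dots> = (\<integral>\<^sup>+w. indicator A w \<partial>distr Q Q (\<lambda>v. v \<circ> inv \<pi>))"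
        using perm_meas[OF inv\<pi>] by (subst nn_integral_distr) (auto simp: sets_Q cong: measurable_cong_sets)
      also have "\<dots> = emeasure Q A"
        using inv[OF inv\<pi>] by (simp add: sets_Q)
      finally show ?thesis .
    qed
    have "emeasure (density ?K (\<lambda>v. ennreal (G v))) A
      = (\<integral>\<^sup>+v. ennreal (G v) * indicator A v \<partial>?K)"
      by (rule emeasure_density) auto
    also have "\<dots> = (\<integral>\<^sup>+v. ennreal (1 / card ?P) * (\<Sum>\<pi>\<in>?P. ennreal (D (v \<circ> \<pi>)) * indicator A v) \<partial>?K)"
    proof (rule nn_integral_cong)
      fix v
      have "ennreal (G v) = ennreal (1 / card ?P) * (\<Sum>\<pi>\<in>?P. ennreal (D (v \<circ> \<pi>)))"
        unfolding G_def using D_nonneg by (simp add: ennreal_mult[symmetric] sum_nonneg sum_ennreal)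
      then show "ennreal (G v) * indicator A v = ennreal (1 / card ?P) * (\<Sum>\<pi>\<in>?P. ennreal (D (v \<circ> \<pi>)) * indicator A v)"
        by (simp add: sum_distrib_right[symmetric] mult.assoc)
    qed
    also have "\<dots> = ennreal (1 / card ?P) * (\<Sum>\<pi>\<in>?P. \<integral>\<^sup>+v. ennreal (D (v \<circ> \<pi>)) * indicator A v \<partial>?K)"
      using D_perm
      by (subst nn_integral_cmult, auto intro!: borel_measurable_sum borel_measurable_times_ennreal)
         (subst nn_integral_sum, auto intro!: borel_measurable_times_ennreal)
    also have "\<dots> = ennreal (1 / card ?P) * (of_nat (card ?P) * emeasure Q A)"
      using summand by simp
    also have "\<dots> = emeasure Q A"
      using card by (simp add: mult.assoc[symmetric] ennreal_of_nat_eq_real_of_nat ennreal_mult[symmetric])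
    finally show "emeasure (density ?K (\<lambda>v. ennreal (G v))) A = emeasure Q A" .
  qed (simp add: sets_Q)
  have "(\<integral>\<^sup>+v. ennreal (G v) \<partial>?K) = emeasure (density ?K (\<lambda>v. ennreal (G v))) (space ?K)"
    using sets.top[of ?K] by (subst emeasure_density) (auto intro!: nn_integral_cong)
  also have "\<dots> = 1"
    using Q.emeasure_space_1 sets_eq_imp_space_eq[OF sets_Q] by (simp add: dens_G)
  finally have "is_density ?K G" using G_nonneg by (simp add: is_density_def)
  moreover have "symmetric_on_sphere N G"
    unfolding symmetric_on_sphere_def G_def
  proof (intro allI impI ballI)
    \<comment> \<open>Composition with \<open>\<sigma>\<close> is a bijection of the group, so it
      only reorders the sum.\<close>
    fix \<sigma> v assume "\<sigma> permutes {..<N}"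
    then show "(\<Sum>\<pi>\<in>?P. D ((v \<circ> \<sigma>) \<circ> \<pi>)) / real (card ?P) = (\<Sum>\<pi>\<in>?P. D (v \<circ> \<pi>)) / real (card ?P)"
      by (subst (2) setum_permutations_compose_left[of \<sigma>]) (simp_all add: o_assoc)
  qed
  ultimately show ?thesis using dens_G that by blast
qed

section \<open>Laws of projected independent samples and their densities\<close>

definition sphere_law :: "real measure \<Rightarrow> nat \<Rightarrow> (nat \<Rightarrow> real) measure" where
  "sphere_law \<mu> N = distr (\<Pi>\<^sub>M i\<in>{..<N}. \<mu>) (kac_uniform N) (sphere_proj N)"

lemma measurable_sphere_proj':
  assumes "sets \<mu> = sets borel"
  shows "sphere_proj N \<in> measurable (\<Pi>\<^sub>M i\<in>{..<N}. \<mu>) (kac_uniform N)"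
  using measurable_sphere_proj by (simp cong: measurable_cong_sets sets_PiM_cong add: assms)

text \<open>The product of identical factors is invariant under permutations, and
  \<open>sphere_proj\<close> commutes with them.\<close>

lemma sphere_law_permutes:
  assumes \<mu>: "prob_space \<mu>" "sets \<mu> = sets borel" and \<pi>: "\<pi> permutes {..<N}"
  shows "distr (sphere_law \<mu> N) (sphere_law \<mu> N) (\<lambda>v. v \<circ> \<pi>) = sphere_law \<mu> N"
proof -
  interpret prob_space \<mu> by fact
  interpret M: product_sigma_finite "\<lambda>_::nat. \<mu>"
    by (simp add: product_sigma_finite_def sigma_finite_measure_axioms)
  let ?M = "\<Pi>\<^sub>M i\<in>{..<N}. \<mu>"
  note sp = measurable_sphere_proj'[OF \<mu>(2), of N]
  have "distr (sphere_law \<mu> N) (sphere_law \<mu> N) (\<lambda>v. v \<circ> \<pi>)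
      = distr (sphere_law \<mu> N) (kac_uniform N) (\<lambda>v. v \<circ> \<pi>)"
    by (rule distr_cong) (auto simp: sphere_law_def)
  also have "\<dots> = distr ?M (kac_uniform N) ((\<lambda>v. v \<circ> \<pi>) \<circ> sphere_proj N)"
    unfolding sphere_law_def by (rule distr_distr[OF measurable_kac_uniform_permutes[OF \<pi>] sp])
  also have "(\<lambda>v. v \<circ> \<pi>) \<circ> sphere_proj N = sphere_proj N \<circ> (\<lambda>v. v \<circ> \<pi>)"
    by (simp add: fun_eq_iff sphere_proj_permutes[OF \<pi>])
  also have "distr ?M (kac_uniform N) (sphere_proj N \<circ> (\<lambda>v. v \<circ> \<pi>))
     = distr (distr ?M ?M (\<lambda>v. v \<circ> \<pi>)) (kac_uniform N) (sphere_proj N)"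
    by (rule distr_distr[OF sp measurable_comp_permutes[OF \<pi>], symmetric])
  also have "\<dots> = sphere_law \<mu> N"
    using M.distr_PiM_permutes[OF _ \<pi>, of \<mu>] by (simp add: sphere_law_def)
  finally show ?thesis .
qed

lemma prob_space_density_lborel:
  assumes "is_density lborel f"
  shows "prob_space (density lborel (\<lambda>x. ennreal (f x)))"
  using assms by (intro prob_spaceI) (simp add: is_density_def emeasure_density)

lemma PiM_density_lborel:
  fixes f :: "real \<Rightarrow> real"
  assumes f: "is_density lborel f" and I: "finite I"
  shows "Pi\<^sub>M I (\<lambda>_. density lborel (\<lambda>x. ennreal (f x)))
     = density (Pi\<^sub>M I (\<lambda>_. lborel)) (\<lambda>x. ennreal (\<Prod>i\<in>I. f (x i)))"
proof -
  interpret product_sigma_finite "\<lambda>_::'a. lborel :: real measure" by (rule product_sigma_finite_lborel)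
  interpret prob_space "density lborel (\<lambda>x. ennreal (f x))" by (rule prob_space_density_lborel[OF f])
  have "Pi\<^sub>M I (\<lambda>_. density lborel (\<lambda>x. ennreal (f x)))
     = density (Pi\<^sub>M I (\<lambda>_. lborel)) (\<lambda>x. \<Prod>i\<in>I. ennreal (f (x i)))"
    using f by (intro PiM_density_eq I)
      (auto simp: is_density_def product_sigma_finite_def sigma_finite_measure_axioms)
  then show ?thesis using f by (simp add: prod_ennreal is_density_def)
qed

text \<open>The sample has a density with respect to Lebesgue measure, and the full cone over a null
  set of the sphere is Lebesgue null.\<close>

lemma sphere_law_absolutely_continuous:
  assumes f: "is_density lborel f" and N: "N \<ge> 1"
  shows "absolutely_continuous (kac_uniform N) (sphere_law (density lborel (\<lambda>x. ennreal (f x))) N)"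
  unfolding absolutely_continuous_def
proof (rule subsetI)
  let ?\<mu> = "density lborel (\<lambda>x. ennreal (f x))"
  let ?M = "\<Pi>\<^sub>M i\<in>{..<N}. ?\<mu>" and ?L = "\<Pi>\<^sub>M i\<in>{..<N}. lborel :: real measure"
  have [measurable]: "f \<in> borel_measurable borel" using f by (simp add: is_density_def)
  fix A assume "A \<in> null_sets (kac_uniform N)"
  then have A: "A \<in> sets (kac_uniform N)" "emeasure (kac_uniform N) A = 0" by auto
  have sp: "sphere_proj N \<in> measurable ?M (kac_uniform N)"
    by (rule measurable_sphere_proj') simp
  have "AE v in ?M. sphere_proj N v \<notin> A"
    unfolding PiM_density_lborel[OF f finite_lessThan]
    using null_full_cone[OF N A] by (subst AE_density) auto
  then have "emeasure ?M (sphere_proj N -` A \<inter> space ?M) = 0"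
    by (intro AE_iff_measurable[THEN iffD1, OF _ _ \<open>AE v in ?M. sphere_proj N v \<notin> A\<close>]
        measurable_sets[OF sp A(1)]) auto
  then show "A \<in> null_sets (sphere_law ?\<mu> N)"
    using A(1) unfolding sphere_law_def by (intro null_setsI) (simp_all add: emeasure_distr[OF sp])
qed

lemma sphere_law_density:
  assumes f: "is_density lborel f" and N: "N \<ge> 1"
  obtains G where "is_density (kac_uniform N) G" "symmetric_on_sphere N G"
    "density (kac_uniform N) (\<lambda>v. ennreal (G v)) = sphere_law (density lborel (\<lambda>x. ennreal (f x))) N"
proof -
  let ?\<mu> = "density lborel (\<lambda>x. ennreal (f x))"
  interpret \<mu>: prob_space ?\<mu> by (rule prob_space_density_lborel[OF f])
  have "prob_space (sphere_law ?\<mu> N)"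
    unfolding sphere_law_def
    by (intro prob_space.prob_space_distr prob_space_PiM measurable_sphere_proj') (auto intro: \<mu>.prob_space_axioms)
  moreover have "distr (sphere_law ?\<mu> N) (sphere_law ?\<mu> N) (\<lambda>v. v \<circ> \<pi>) = sphere_law ?\<mu> N"
    if "\<pi> permutes {..<N}" for \<pi>
    using that by (intro sphere_law_permutes \<mu>.prob_space_axioms) auto
  moreover have "sets (sphere_law ?\<mu> N) = sets (kac_uniform N)"
    by (simp add: sphere_law_def)
  ultimately show ?thesis
    using exists_symmetric_density[OF N _ _ sphere_law_absolutely_continuous[OF f N]] that by metis
qed

section \<open>Chaos by the weak law of large numbers\<close>

text \<open>All dimensions are treated on one space of infinite sequences; this makes a test
  function of the coordinates in \<open>I\<close> a continuous function there.\<close>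

lemma continuous_map_extend_restrict:
  fixes \<phi> :: "('i \<Rightarrow> real) \<Rightarrow> real"
  assumes "continuous_map (powertop_real I) euclideanreal \<phi>"
  shows "continuous_on UNIV (\<lambda>x. \<phi> (restrict x I))"
proof -
  have "continuous_map (powertop_real UNIV) (powertop_real I) (\<lambda>x. restrict x I)"
    by (subst continuous_map_componentwise) (auto intro: continuous_map_product_projection)
  from continuous_map_compose[OF this assms]
  show ?thesis by (simp add: o_def euclidean_product_topology)
qed

lemma borel_measurable_continuous_map_PiM:
  fixes \<phi> :: "('i::countable \<Rightarrow> real) \<Rightarrow> real"
  assumes "continuous_map (powertop_real I) euclideanreal \<phi>"
  shows "(\<lambda>x. \<phi> (restrict x I)) \<in> borel_measurable (Pi\<^sub>M UNIV (\<lambda>_. borel))"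
    and "\<phi> \<in> borel_measurable (Pi\<^sub>M I (\<lambda>_. borel))"
proof -
  show *: "(\<lambda>x. \<phi> (restrict x I)) \<in> borel_measurable (Pi\<^sub>M UNIV (\<lambda>_. borel))"
    using borel_measurable_continuous_onI[OF continuous_map_extend_restrict[OF assms]]
    by (simp add: sets_PiM_equal_borel cong: measurable_cong_sets)
  \<comment> \<open>Padding a point with zeros and restricting it again gives the point back, so
    measurability on the full product passes to the partial one.\<close>
  have ext: "(\<lambda>x i. if i \<in> I then x i else 0) \<in> measurable (Pi\<^sub>M I (\<lambda>_. borel)) (Pi\<^sub>M UNIV (\<lambda>_. borel :: real measure))"
  proof (rule measurable_PiM_single')
    show "(\<lambda>x. if i \<in> I then x i else 0) \<in> borel_measurable (Pi\<^sub>M I (\<lambda>_. borel :: real measure))" for i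
      by (cases "i \<in> I") auto
  qed (auto simp: space_PiM)
  have "\<phi> x = \<phi> (restrict (\<lambda>i. if i \<in> I then x i else 0) I)" if "x \<in> space (Pi\<^sub>M I (\<lambda>_. borel))" for x
    using that by (intro arg_cong[where f=\<phi>]) (auto simp: space_PiM PiE_iff extensional_def restrict_def fun_eq_iff)
  then show "\<phi> \<in> borel_measurable (Pi\<^sub>M I (\<lambda>_. borel))"
    using measurable_compose[OF ext *] by (subst measurable_cong) auto
qed

text \<open>If the integrals did not converge, some subsequence of them would avoid a neighbourhood
  of the limit. Convergence of \<open>u\<close> in mean yields a further subsequence along which
  \<open>u\<close> tends to 0 almost everywhere; \<open>conv\<close> and dominated convergence then
  give a contradiction.\<close>

lemma tendsto_integral_subseq:
  fixes h :: "nat \<Rightarrow> 'a \<Rightarrow> real" and u :: "nat \<Rightarrow> 'a \<Rightarrow> real"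
  assumes "finite_measure M"
    and u: "\<And>n. integrable M (u n)" "(\<lambda>n. \<integral>x. norm (u n x) \<partial>M) \<longlonglongrightarrow> 0"
    and h: "\<And>n. h n \<in> borel_measurable M" "g \<in> borel_measurable M" "\<And>n x. \<bar>h n x\<bar> \<le> B"
    and conv: "\<And>r x. strict_mono r \<Longrightarrow> x \<in> space M \<Longrightarrow> (\<lambda>n. u (r n) x) \<longlonglongrightarrow> 0 \<Longrightarrow> (\<lambda>n. h (r n) x) \<longlonglongrightarrow> g x"
  shows "(\<lambda>n. \<integral>x. h n x \<partial>M) \<longlonglongrightarrow> (\<integral>x. g x \<partial>M)"
proof (rule ccontr)
  interpret finite_measure M by fact
  assume "\<not> (\<lambda>n. \<integral>x. h n x \<partial>M) \<longlonglongrightarrow> (\<integral>x. g x \<partial>M)"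
  then obtain S where S: "open S" "(\<integral>x. g x \<partial>M) \<in> S" "\<not> (\<forall>\<^sub>F n in sequentially. (\<integral>x. h n x \<partial>M) \<in> S)"
    unfolding tendsto_def by blast
  from not_eventually_sequentiallyD[OF S(3)] obtain r :: "nat \<Rightarrow> nat"
    where r: "strict_mono r" "\<And>n. (\<integral>x. h (r n) x \<partial>M) \<notin> S" by blast
  have "(\<lambda>n. \<integral>x. norm (u (r n) x) \<partial>M) \<longlonglongrightarrow> 0"
    using LIMSEQ_subseq_LIMSEQ[OF u(2) r(1)] by (simp add: o_def)
  from tendsto_L1_AE_subseq[OF u(1) this] obtain s where s: "strict_mono s"
    "AE x in M. (\<lambda>n. u (r (s n)) x) \<longlonglongrightarrow> 0" by blast
  have rs: "strict_mono (\<lambda>n. r (s n))" using r(1) s(1) by (rule strict_mono_compose)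
  have "(\<lambda>n. \<integral>x. h (r (s n)) x \<partial>M) \<longlonglongrightarrow> (\<integral>x. g x \<partial>M)"
  proof (rule integral_dominated_convergence[where w="\<lambda>_. B"])
    show "AE x in M. (\<lambda>n. h (r (s n)) x) \<longlonglongrightarrow> g x"
      using s(2) AE_space by eventually_elim (rule conv[OF rs])
  qed (use h in auto)
  then have "\<forall>\<^sub>F n in sequentially. (\<integral>x. h (r (s n)) x \<partial>M) \<in> S"
    using S by (simp add: tendsto_def)
  then show False using r(2) by (auto simp: eventually_sequentially)
qed

text \<open>The variance of a sum of independent centred variables: after expanding the square, the
  mixed terms factor and vanish, and the \<open>N\<close> diagonal terms remain.\<close>

lemma integral_PiM_sum_square:
  fixes g :: "real \<Rightarrow> real"
  assumes "prob_space \<mu>" and g: "integrable \<mu> g" "(\<integral>x. g x \<partial>\<mu>) = 0" and g2: "integrable \<mu> (\<lambda>x. (g x)\<^sup>2)"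
  shows "integrable (\<Pi>\<^sub>M i\<in>(UNIV::nat set). \<mu>) (\<lambda>\<omega>. (\<Sum>i<N. g (\<omega> i))\<^sup>2)"
    and "(\<integral>\<omega>. (\<Sum>i<N. g (\<omega> i))\<^sup>2 \<partial>(\<Pi>\<^sub>M i\<in>(UNIV::nat set). \<mu>)) = real N * (\<integral>x. (g x)\<^sup>2 \<partial>\<mu>)"
proof -
  interpret \<mu>: prob_space \<mu> by fact
  interpret product_prob_space "\<lambda>_::nat. \<mu>" UNIV ..
  let ?P = "\<Pi>\<^sub>M i\<in>(UNIV::nat set). \<mu>"
  have [measurable]: "g \<in> borel_measurable \<mu>" using g(1) by simp
  have prod: "integrable ?P (\<lambda>\<omega>. g (\<omega> i) * g (\<omega> j)) \<and>
      (\<integral>\<omega>. g (\<omega> i) * g (\<omega> j) \<partial>?P) = (if i = j then \<integral>x. (g x)\<^sup>2 \<partial>\<mu> else 0)" for i j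
  proof (cases "i = j")
    case True
    have d: "distr ?P \<mu> (\<lambda>\<omega>. \<omega> i) = \<mu>" by (intro distr_PiM_component) (auto intro: \<mu>.prob_space_axioms)
    have "integrable (distr ?P \<mu> (\<lambda>\<omega>. \<omega> i)) (\<lambda>x. (g x)\<^sup>2)" unfolding d by (rule g2)
    then have "integrable ?P (\<lambda>\<omega>. (g (\<omega> i))\<^sup>2)" by (subst (asm) integrable_distr_eq) auto
    moreover have "(\<integral>\<omega>. (g (\<omega> i))\<^sup>2 \<partial>?P) = (\<integral>x. (g x)\<^sup>2 \<partial>distr ?P \<mu> (\<lambda>\<omega>. \<omega> i))"
      by (subst integral_distr) auto
    ultimately show ?thesis using True unfolding d by (simp add: power2_eq_square)
  next
    case False
    let ?J = "{i, j}" and ?F = "\<lambda>x. \<Prod>k\<in>{i, j}. g (x k)"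
    have d: "distr ?P (Pi\<^sub>M ?J (\<lambda>_. \<mu>)) (\<lambda>x. restrict x ?J) = Pi\<^sub>M ?J (\<lambda>_. \<mu>)"
      by (rule distr_PiM_restrict_finite) auto
    have res: "(\<lambda>x. restrict x ?J) \<in> measurable ?P (Pi\<^sub>M ?J (\<lambda>_. \<mu>))"
      by (rule measurable_restrict_subset) simp
    have F: "?F \<in> borel_measurable (Pi\<^sub>M ?J (\<lambda>_. \<mu>))"
      by (intro borel_measurable_prod measurable_compose[OF measurable_component_singleton]) auto
    have "integrable (Pi\<^sub>M ?J (\<lambda>_. \<mu>)) ?F"
      by (rule product_integrable_prod) (auto intro: g)
    then have "integrable (distr ?P (Pi\<^sub>M ?J (\<lambda>_. \<mu>)) (\<lambda>x. restrict x ?J)) ?F" by (simp only: d)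
    then have "integrable ?P (\<lambda>\<omega>. ?F (restrict \<omega> ?J))"
      by (rule integrable_distr[OF res])
    moreover have "(\<integral>\<omega>. ?F (restrict \<omega> ?J) \<partial>?P) = 0"
    proof -
      have "(\<integral>\<omega>. ?F (restrict \<omega> ?J) \<partial>?P) = (\<integral>x. ?F x \<partial>distr ?P (Pi\<^sub>M ?J (\<lambda>_. \<mu>)) (\<lambda>x. restrict x ?J))"
        using res F by (subst integral_distr) auto
      also have "\<dots> = (\<Prod>k\<in>?J. \<integral>x. g x \<partial>\<mu>)"
        unfolding d by (rule product_integral_prod) (auto intro: g)
      finally show ?thesis by (simp add: g(2) card_gt_0_iff)
    qed
    ultimately show ?thesis using False by simp
  qed
  have sq: "(\<Sum>i<N. g (\<omega> i))\<^sup>2 = (\<Sum>i<N. \<Sum>j<N. g (\<omega> i) * g (\<omega> j))" for \<omega> :: "nat \<Rightarrow> real"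
    by (simp add: power2_eq_square sum_product)
  show "integrable ?P (\<lambda>\<omega>. (\<Sum>i<N. g (\<omega> i))\<^sup>2)"
    unfolding sq using prod by (intro Bochner_Integration.integrable_sum) auto
  have "(\<integral>\<omega>. (\<Sum>i<N. g (\<omega> i))\<^sup>2 \<partial>?P) = (\<Sum>i<N. \<Sum>j<N. if i = j then \<integral>x. (g x)\<^sup>2 \<partial>\<mu> else 0)"
    unfolding sq using prod by (simp add: Bochner_Integration.integral_sum)
  then show "(\<integral>\<omega>. (\<Sum>i<N. g (\<omega> i))\<^sup>2 \<partial>?P) = real N * (\<integral>x. (g x)\<^sup>2 \<partial>\<mu>)" by simp
qed

text \<open>A basic open set of the product topology constrains only finitely many coordinates, so
  finitely many eventual conditions are combined.\<close>

lemma tendsto_coordinatewise: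
  fixes f :: "'a \<Rightarrow> 'i \<Rightarrow> 'b::topological_space"
  assumes "\<And>i. ((\<lambda>n. f n i) \<longlongrightarrow> l i) F"
  shows "(f \<longlongrightarrow> l) F"
proof (rule topological_tendstoI)
  fix S assume "open S" "l \<in> S"
  then have "openin (product_topology (\<lambda>_. euclidean) UNIV) S" by (simp only: open_fun_def)
  from product_topology_open_contains_basis[OF this \<open>l \<in> S\<close>] obtain X where X: "l \<in> (\<Pi>\<^sub>E i\<in>UNIV. X i)" "\<And>i. open (X i)" "finite {i. X i \<noteq> UNIV}" "(\<Pi>\<^sub>E i\<in>UNIV. X i) \<subseteq> S"
    by auto
  have "\<forall>\<^sub>F n in F. \<forall>i\<in>{i. X i \<noteq> UNIV}. f n i \<in> X i"
  proof (intro eventually_ball_finite ballI X(3))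
    show "\<forall>\<^sub>F n in F. f n i \<in> X i" for i
      using X(1) by (intro topological_tendstoD[OF assms X(2)]) auto
  qed
  then show "\<forall>\<^sub>F n in F. f n \<in> S"
  proof eventually_elim
    case (elim n)
    then have "f n i \<in> X i" for i by (cases "X i = UNIV") auto
    then show ?case using X(4) by auto
  qed
qed

text \<open>The projection divides each coordinate by the root of the mean square, which tends to
  1.\<close>

lemma sphere_proj_tendsto:
  assumes r: "strict_mono r" and conv: "(\<lambda>n. sq_norm (r n) v / real (r n)) \<longlonglongrightarrow> 1"
  shows "(\<lambda>n. sphere_proj (r n) v) \<longlonglongrightarrow> v"
proof (rule tendsto_coordinatewise)
  fix i
  \<comment> \<open>Any bound in (0, 1) would serve: it keeps the vector away from the default case
    of \<open>sphere_proj\<close>. The condition \<open>r n > i\<close> ensures that coordinate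
    \<open>i\<close> is present.\<close>
  have "\<forall>\<^sub>F n in sequentially. sq_norm (r n) v / real (r n) > 1 / 2"
    using conv by (rule order_tendstoD) simp
  moreover have "\<forall>\<^sub>F n in sequentially. r n > i"
    by (rule eventually_subseq[OF r eventually_gt_at_top])
  ultimately have ev: "\<forall>\<^sub>F n in sequentially. v i / sqrt (sq_norm (r n) v / real (r n)) = sphere_proj (r n) v i"
  proof eventually_elim
    case (elim n)
    then have "0 < sq_norm (r n) v" by (auto simp: field_simps)
    then show ?case using elim by (simp add: sphere_proj_def radial_proj_def real_sqrt_divide)
  qed
  have "(\<lambda>n. v i / sqrt (sq_norm (r n) v / real (r n))) \<longlonglongrightarrow> v i / sqrt 1"
    by (intro tendsto_intros conv) simp
  then show "(\<lambda>n. sphere_proj (r n) v i) \<longlonglongrightarrow> v i"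
    using tendsto_cong[OF ev] by simp
qed

lemma measurable_sphere_proj_UNIV:
  "sphere_proj N \<in> measurable (Pi\<^sub>M UNIV (\<lambda>_. borel)) (Pi\<^sub>M UNIV (\<lambda>_. borel))"
proof (rule measurable_PiM_single')
  have [measurable]: "sq_norm N \<in> borel_measurable (Pi\<^sub>M UNIV (\<lambda>_. borel))"
    unfolding sq_norm_def by measurable
  show "(\<lambda>x. sphere_proj N x i) \<in> borel_measurable (Pi\<^sub>M UNIV (\<lambda>_. borel))" for i
    by (cases "i < N") (simp_all add: sphere_proj_def radial_proj_def restrict_def if_distrib[where f="\<lambda>g. g i"] cong: if_cong)
qed (auto simp: space_PiM)

lemma borel_measurable_restrict_kac_uniform:
  assumes \<phi>: "continuous_map (powertop_real {..<k}) euclideanreal \<phi>" and "k \<le> N"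
  shows "(\<lambda>v. \<phi> (restrict v {..<k})) \<in> borel_measurable (kac_uniform N)"
proof -
  have "(\<lambda>v. restrict v {..<k}) \<in> measurable (\<Pi>\<^sub>M i\<in>{..<N}. borel) (\<Pi>\<^sub>M i\<in>{..<k}. borel :: real measure)"
    using assms by (intro measurable_restrict_subset) auto
  from measurable_restrict_space1[OF measurable_compose[OF this borel_measurable_continuous_map_PiM(2)[OF \<phi>]]]
  show ?thesis by (simp cong: measurable_cong_sets add: sets_kac_uniform)
qed

text \<open>All samples are initial segments of one infinite independent sequence. The fourth moment
  makes the mean square converge to 1 in the L2 sense, so along subsequences the projected points
  converge coordinatewise to the sequence itself, and \<open>tendsto_integral_subseq\<close> passes
  to the limit in the bounded continuous test function.\<close>

lemma sphere_law_tendsto: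
  fixes \<mu> :: "real measure"
  assumes \<mu>: "prob_space \<mu>" "sets \<mu> = sets borel"
    and m2: "integrable \<mu> (\<lambda>x. x\<^sup>2)" "(\<integral>x. x\<^sup>2 \<partial>\<mu>) = 1"
    and m4: "integrable \<mu> (\<lambda>x. x ^ 4)"
    and \<phi>: "continuous_map (powertop_real {..<k}) euclideanreal \<phi>"
    and bdd: "bounded (\<phi> ` ({..<k} \<rightarrow>\<^sub>E UNIV))"
  shows "(\<lambda>N. \<integral>v. \<phi> (restrict v {..<k}) \<partial>sphere_law \<mu> N) \<longlonglongrightarrow> (\<integral>x. \<phi> x \<partial>(\<Pi>\<^sub>M i\<in>{..<k}. \<mu>))"
proof -
  interpret \<mu>: prob_space \<mu> by fact
  interpret product_prob_space "\<lambda>_::nat. \<mu>" UNIV ..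
  let ?P = "\<Pi>\<^sub>M i\<in>(UNIV::nat set). \<mu>"
  interpret P: prob_space ?P by (intro prob_space_PiM \<mu>(1))
  define \<psi> where "\<psi> x = \<phi> (restrict x {..<k})" for x
  have sets_M: "sets (Pi\<^sub>M J (\<lambda>_. \<mu>)) = sets (Pi\<^sub>M J (\<lambda>_. borel))" for J :: "nat set"
    by (rule sets_PiM_cong) (auto simp: \<mu>(2))
  have sp_\<mu>: "space \<mu> = UNIV" using sets_eq_imp_space_eq[OF \<mu>(2)] by simp
  obtain B where B: "\<And>x. \<bar>\<psi> x\<bar> \<le> B"
  proof -
    obtain B where B: "\<And>y. y \<in> \<phi> ` ({..<k} \<rightarrow>\<^sub>E UNIV) \<Longrightarrow> \<bar>y\<bar> \<le> B"
      using bdd by (auto simp: bounded_iff)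
    show ?thesis by (rule that[of B]) (auto simp: \<psi>_def intro!: B)
  qed
  have \<psi>_meas: "\<psi> \<in> borel_measurable ?P"
    using borel_measurable_continuous_map_PiM(1)[OF \<phi>] unfolding \<psi>_def[abs_def]
    by (simp cong: measurable_cong_sets add: sets_M)
  have \<psi>_proj_meas: "(\<lambda>\<omega>. \<psi> (sphere_proj N \<omega>)) \<in> borel_measurable ?P" for N
    using measurable_compose[OF measurable_sphere_proj_UNIV borel_measurable_continuous_map_PiM(1)[OF \<phi>]]
    unfolding \<psi>_def by (simp cong: measurable_cong_sets add: sets_M)
  define g where "g x = x\<^sup>2 - 1" for x :: real
  have g: "integrable \<mu> g" "(\<integral>x. g x \<partial>\<mu>) = 0"
    using m2 by (auto simp: g_def[abs_def] \<mu>.prob_space)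
  have "(g x)\<^sup>2 = x ^ 4 - 2 * x\<^sup>2 + 1" for x
    by (simp add: g_def power2_eq_square power4_eq_xxxx algebra_simps)
  then have g2: "integrable \<mu> (\<lambda>x. (g x)\<^sup>2)" using m2 m4 by auto
  \<comment> \<open>The squared deviation of the mean square from 1, written through centred
    summands so that the variance formula applies. At \<open>N = 0\<close> division by zero makes it
    0, hence the condition in \<open>u_eq\<close>.\<close>
  define u where "u N \<omega> = ((\<Sum>i<N. g (\<omega> i)) / real N)\<^sup>2" for N and \<omega> :: "nat \<Rightarrow> real"
  have u_eq: "u N \<omega> = (sq_norm N \<omega> / real N - 1)\<^sup>2" if "N > 0" for N \<omega>
    using that by (simp add: u_def g_def sum_subtractf sq_norm_def diff_divide_distrib)
  have "(\<lambda>N. \<integral>\<omega>. \<psi> (sphere_proj N \<omega>) \<partial>?P) \<longlonglongrightarrow> (\<integral>\<omega>. \<psi> \<omega> \<partial>?P)"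
  proof (rule tendsto_integral_subseq[where u=u and B=B])
    show "finite_measure ?P" by (rule P.finite_measure_axioms)
    show u_int: "integrable ?P (u n)" for n
      unfolding u_def[abs_def] power_divide
      using integral_PiM_sum_square(1)[OF \<mu>(1) g g2] by (rule integrable_divide)
    \<comment> \<open>The variance of a mean of \<open>n\<close> independent terms is the single
      variance over \<open>n\<close>; at \<open>n = 0\<close> both sides are 0.\<close>
    have "(\<integral>\<omega>. norm (u n \<omega>) \<partial>?P) = (\<integral>x. (g x)\<^sup>2 \<partial>\<mu>) * inverse (real n)" for n
    proof -
      have "(\<integral>\<omega>. norm (u n \<omega>) \<partial>?P) = (\<integral>\<omega>. (\<Sum>i<n. g (\<omega> i))\<^sup>2 \<partial>?P) / (real n)\<^sup>2"
        by (simp add: u_def power_divide)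
      then show ?thesis
        using integral_PiM_sum_square(2)[OF \<mu>(1) g g2, of n]
        by (simp add: power2_eq_square field_simps)
    qed
    moreover have "(\<lambda>n. (\<integral>x. (g x)\<^sup>2 \<partial>\<mu>) * inverse (real n)) \<longlonglongrightarrow> (\<integral>x. (g x)\<^sup>2 \<partial>\<mu>) * 0"
      by (intro tendsto_mult tendsto_const lim_inverse_n)
    ultimately show "(\<lambda>n. \<integral>\<omega>. norm (u n \<omega>) \<partial>?P) \<longlonglongrightarrow> 0" by simp
    fix r :: "nat \<Rightarrow> nat" and \<omega>
    assume r: "strict_mono r" and "(\<lambda>n. u (r n) \<omega>) \<longlonglongrightarrow> 0"
    then have "(\<lambda>n. sqrt (u (r n) \<omega>)) \<longlonglongrightarrow> sqrt 0" by (intro tendsto_real_sqrt)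
    moreover have "\<forall>\<^sub>F n in sequentially. sqrt (u (r n) \<omega>) = \<bar>sq_norm (r n) \<omega> / real (r n) - 1\<bar>"
      using eventually_subseq[OF r eventually_gt_at_top[of 0]] by eventually_elim (simp add: u_eq)
    ultimately have "(\<lambda>n. \<bar>sq_norm (r n) \<omega> / real (r n) - 1\<bar>) \<longlonglongrightarrow> 0"
      by (simp add: tendsto_cong)
    then have "(\<lambda>n. sq_norm (r n) \<omega> / real (r n)) \<longlonglongrightarrow> 1"
      by (simp add: tendsto_rabs_zero_iff LIM_zero_iff)
    from sphere_proj_tendsto[OF r this]
    show "(\<lambda>n. \<psi> (sphere_proj (r n) \<omega>)) \<longlonglongrightarrow> \<psi> \<omega>"
      unfolding \<psi>_def
      by (rule continuous_on_tendsto_compose[OF continuous_map_extend_restrict[OF \<phi>]]) auto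
  qed (use B \<psi>_meas \<psi>_proj_meas in auto)
  \<comment> \<open>The projection to the sphere in dimension \<open>N\<close> reads only the first
    \<open>N\<close> coordinates, whose joint law is the finite product. For
    \<open>N \<ge> k\<close> the test function is measurable on the sphere.\<close>
  moreover have "\<forall>\<^sub>F N in sequentially. (\<integral>\<omega>. \<psi> (sphere_proj N \<omega>) \<partial>?P) = (\<integral>v. \<phi> (restrict v {..<k}) \<partial>sphere_law \<mu> N)"
    using eventually_ge_at_top[of k]
  proof eventually_elim
    case (elim N)
    let ?M = "\<Pi>\<^sub>M i\<in>{..<N}. \<mu>"
    have d: "distr ?P ?M (\<lambda>x. restrict x {..<N}) = ?M" by (rule distr_PiM_restrict_finite) auto
    have \<phi>_sphere: "(\<lambda>v. \<phi> (restrict v {..<k})) \<in> borel_measurable (kac_uniform N)"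
      by (rule borel_measurable_restrict_kac_uniform[OF \<phi> elim])
    note sp = measurable_sphere_proj'[OF \<mu>(2), of N]
    have "(\<integral>v. \<phi> (restrict v {..<k}) \<partial>sphere_law \<mu> N) = (\<integral>x. \<phi> (restrict (sphere_proj N x) {..<k}) \<partial>?M)"
      unfolding sphere_law_def by (rule integral_distr[OF sp \<phi>_sphere])
    also have "\<dots> = (\<integral>x. \<phi> (restrict (sphere_proj N x) {..<k}) \<partial>distr ?P ?M (\<lambda>x. restrict x {..<N}))"
      by (simp only: d)
    also have "\<dots> = (\<integral>\<omega>. \<phi> (restrict (sphere_proj N (restrict \<omega> {..<N})) {..<k}) \<partial>?P)"
      using measurable_compose[OF sp \<phi>_sphere]
      by (intro integral_distr) (auto intro: measurable_restrict_subset)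
    finally show ?case by (simp add: sphere_proj_restrict \<psi>_def)
  qed
  moreover have "(\<integral>\<omega>. \<psi> \<omega> \<partial>?P) = (\<integral>x. \<phi> x \<partial>(\<Pi>\<^sub>M i\<in>{..<k}. \<mu>))"
  proof -
    let ?M = "\<Pi>\<^sub>M i\<in>{..<k}. \<mu>"
    have d: "distr ?P ?M (\<lambda>x. restrict x {..<k}) = ?M" by (rule distr_PiM_restrict_finite) auto
    have "\<phi> \<in> borel_measurable ?M"
      using borel_measurable_continuous_map_PiM(2)[OF \<phi>] by (simp cong: measurable_cong_sets add: sets_M)
    then have "(\<integral>x. \<phi> x \<partial>distr ?P ?M (\<lambda>x. restrict x {..<k})) = (\<integral>\<omega>. \<psi> \<omega> \<partial>?P)"
      unfolding \<psi>_def by (intro integral_distr) (auto intro: measurable_restrict_subset)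
    then show ?thesis by (simp only: d)
  qed
  ultimately show ?thesis by (simp add: tendsto_cong)
qed

section \<open>Small symmetric sets\<close>

text \<open>By Tonelli in coordinate \<open>i\<close>: with the other coordinates fixed, equality
  leaves a single point of the line.\<close>

lemma AE_PiM_lborel_distinct_components:
  fixes I :: "'i set"
  assumes I: "finite I" "i \<in> I" "j \<in> I" "i \<noteq> j"
  shows "AE v in Pi\<^sub>M I (\<lambda>_. lborel :: real measure). v i \<noteq> v j"
proof -
  interpret product_sigma_finite "\<lambda>_::'i. lborel :: real measure" by (rule product_sigma_finite_lborel)
  let ?J = "I - {i}"
  have eq: "I = insert i ?J" using I by auto
  have [measurable]: "(\<lambda>v. v k) \<in> measurable (Pi\<^sub>M I (\<lambda>_. lborel :: real measure)) borel" if "k \<in> I" for k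
    using measurable_component_singleton[OF that, of "\<lambda>_. lborel :: real measure"] by simp
  have A: "{v \<in> space (Pi\<^sub>M I (\<lambda>_. lborel :: real measure)). v i = v j} \<in> sets (Pi\<^sub>M I (\<lambda>_. lborel))" (is "?A \<in> _")
    using I by measurable
  have "emeasure (Pi\<^sub>M I (\<lambda>_. lborel)) ?A = (\<integral>\<^sup>+v. indicator ?A v \<partial>Pi\<^sub>M (insert i ?J) (\<lambda>_. lborel))"
    using A eq by simp
  also have "\<dots> = (\<integral>\<^sup>+x. \<integral>\<^sup>+y. indicator ?A (x(i := y)) \<partial>lborel \<partial>Pi\<^sub>M ?J (\<lambda>_. lborel))"
    using I A eq by (intro product_nn_integral_insert) auto
  also have "\<dots> = (\<integral>\<^sup>+x. \<integral>\<^sup>+y. indicator {x j} y \<partial>(lborel :: real measure) \<partial>Pi\<^sub>M ?J (\<lambda>_. lborel :: real measure))"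
    using I by (intro nn_integral_cong) (auto simp: indicator_def space_PiM PiE_iff extensional_def)
  also have "\<dots> = 0" by simp
  finally show ?thesis
    using A by (subst AE_iff_measurable[OF A]) auto
qed

text \<open>The sets \<open>A n\<close> are neighbourhoods of (1, ..., 1), a point fixed by all
  permutations. They shrink to that point, whose cone is a Lebesgue null set, so their measures tend
  to 0; each measure is positive because the cone over \<open>A n\<close> contains a cube.\<close>

lemma exists_small_symmetric_set:
  assumes N: "N \<ge> 2" and e: "e > 0"
  obtains A where "A \<in> sets (kac_uniform N)" "0 < measure (kac_uniform N) A" "measure (kac_uniform N) A \<le> e"
    "\<And>\<pi> v. \<pi> permutes {..<N} \<Longrightarrow> v \<in> kac_sphere N \<Longrightarrow> v \<circ> \<pi> \<in> A \<longleftrightarrow> v \<in> A"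
proof -
  let ?K = "kac_uniform N" and ?L = "\<Pi>\<^sub>M i\<in>{..<N}. lborel :: real measure"
  interpret L: product_sigma_finite "\<lambda>_::nat. lborel :: real measure" by (rule product_sigma_finite_lborel)
  have N1: "N \<ge> 1" using N by simp
  interpret K: prob_space ?K by (rule prob_space_kac_uniform[OF N1])
  define A where "A n = {v \<in> kac_sphere N. \<forall>i<N. \<bar>v i - 1\<bar> < inverse (real (Suc n))}" for n
  have coord[measurable]: "(\<lambda>v. v i) \<in> borel_measurable ?K" if "i < N" for i
  proof -
    have "(\<lambda>v. v i) \<in> borel_measurable (restrict_space (\<Pi>\<^sub>M i\<in>{..<N}. borel :: real measure) (kac_sphere N))"
      using that by (intro measurable_restrict_space1 measurable_component_singleton) auto
    then show ?thesis by (simp cong: measurable_cong_sets add: sets_kac_uniform)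
  qed
  have A_sets[measurable]: "A n \<in> sets ?K" for n
  proof -
    have "A n = {v \<in> space ?K. \<forall>i\<in>{..<N}. \<bar>v i - 1\<bar> < inverse (real (Suc n))}" by (auto simp: A_def)
    also have "\<dots> \<in> sets ?K" by measurable
    finally show ?thesis .
  qed
  have sym: "v \<circ> \<pi> \<in> A n \<longleftrightarrow> v \<in> A n" if \<pi>: "\<pi> permutes {..<N}" and v: "v \<in> kac_sphere N" for \<pi> v n
  proof -
    have "(\<forall>i\<in>{..<N}. \<bar>v (\<pi> i) - 1\<bar> < inverse (real (Suc n))) \<longleftrightarrow> (\<forall>i\<in>\<pi> ` {..<N}. \<bar>v i - 1\<bar> < inverse (real (Suc n)))"
      by blast
    then show ?thesis
      unfolding permutes_image[OF \<pi>] using kac_sphere_permutes[OF \<pi> v] v by (simp add: A_def Ball_def)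
  qed
  have dec: "decseq A"
    unfolding decseq_def A_def by (auto intro: less_le_trans le_imp_inverse_le)
  have Inter: "(\<Inter>n. A n) \<in> sets ?K" by auto
  \<comment> \<open>Here \<open>N \<ge> 2\<close> enters: the cone over (1, ..., 1) lies in the
    hyperplane where the first two coordinates agree. For \<open>N = 1\<close> the sphere consists
    of two points of mass 1/2.\<close>
  have distinct: "AE v in ?L. v 0 \<noteq> v (Suc 0)"
    using N by (intro AE_PiM_lborel_distinct_components) auto
  have "AE v in ?L. v \<notin> cone_ball N (\<Inter>n. A n)"
    using distinct
  proof eventually_elim
    case ne: (elim v)
    show ?case
    proof
      assume "v \<in> cone_ball N (\<Inter>n. A n)"
      then have pos: "0 < sq_norm N v" and in_A: "\<And>n. radial_proj N v \<in> A n"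
        by (auto simp: cone_ball_def punctured_ball_def)
      have one: "radial_proj N v i = 1" if "i < N" for i
      proof (rule ccontr)
        assume "radial_proj N v i \<noteq> 1"
        then have "0 < \<bar>radial_proj N v i - 1\<bar>" by simp
        from reals_Archimedean[OF this] obtain n where "inverse (real (Suc n)) < \<bar>radial_proj N v i - 1\<bar>" by blast
        moreover have "\<bar>radial_proj N v i - 1\<bar> < inverse (real (Suc n))" using in_A[of n] that by (simp add: A_def)
        ultimately show False by simp
      qed
      have "radial_proj N v 0 = radial_proj N v (Suc 0)" using one N by simp
      then show False using ne(1) pos N by (simp add: radial_proj_def)
    qed
  qed
  then have "emeasure ?L (cone_ball N (\<Inter>n. A n)) = 0"
    using AE_iff_null_sets[OF cone_ball_sets[OF Inter]] by auto
  then have "emeasure ?K (\<Inter>n. A n) = 0"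
    using emeasure_kac_uniform_eq_0_iff[OF N1 Inter] by simp
  then have "measure ?K (\<Inter>n. A n) = 0" by (simp add: measure_def)
  moreover have "(\<lambda>n. measure ?K (A n)) \<longlonglongrightarrow> measure ?K (\<Inter>n. A n)"
    by (rule K.finite_Lim_measure_decseq) (use dec in auto)
  ultimately have "\<forall>\<^sub>F n in sequentially. measure ?K (A n) < e"
    using e by (intro order_tendstoD(2)) auto
  then obtain n where n: "measure ?K (A n) < e" by (auto simp: eventually_sequentially)
  define d where "d = inverse (real (Suc n))"
  have d: "d > 0" by (simp add: d_def)
  \<comment> \<open>On the cube with sides \<open>[a, 1]\<close> the norm lies between
    \<open>a * sqrt N\<close> and \<open>sqrt N\<close>, so projected coordinates lie in
    \<open>[a, inverse a]\<close>. This choice puts that interval strictly within distance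
    \<open>d\<close> of 1.\<close>
  define a where "a = inverse (1 + d / 2)"
  have a: "0 < a" "a < 1" "1 - a < d" "inverse a < 1 + d"
    using d by (auto simp: a_def field_simps add_pos_pos)
  have "({..<N} \<rightarrow>\<^sub>E {a..1}) \<subseteq> cone_ball N (A n)"
  proof
    fix v assume v: "v \<in> {..<N} \<rightarrow>\<^sub>E {a..1}"
    have vb: "a \<le> v i" "v i \<le> 1" if "i < N" for i using v that by (auto simp: PiE_iff)
    have "(\<Sum>i<N. a\<^sup>2) \<le> sq_norm N v"
      unfolding sq_norm_def using vb a by (intro sum_mono power_mono) auto
    then have lo: "real N * a\<^sup>2 \<le> sq_norm N v" by simp
    have "sq_norm N v \<le> (\<Sum>i<N. 1)"
      unfolding sq_norm_def
    proof (rule sum_mono)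
      fix i assume "i \<in> {..<N}"
      then have "0 \<le> v i" "v i \<le> 1" using vb[of i] a by auto
      then show "(v i)\<^sup>2 \<le> 1" by (simp add: power_le_one)
    qed
    then have hi: "sq_norm N v \<le> real N" by simp
    have pos: "0 < sq_norm N v"
      using lo a N by (intro less_le_trans[OF _ lo]) auto
    have slo: "sqrt (real N) * a \<le> sqrt (sq_norm N v)"
      using real_sqrt_le_mono[OF lo] a by (simp add: real_sqrt_mult)
    have shi: "sqrt (sq_norm N v) \<le> sqrt (real N)" using hi by simp
    have sN: "sqrt (real N) > 0" using N by simp
    have "\<bar>radial_proj N v i - 1\<bar> < d" if i: "i < N" for i
    proof -
      let ?q = "sqrt (sq_norm N v)"
      have q: "?q > 0" using pos by simp
      have "a * ?q \<le> sqrt (real N) * v i"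
        using mult_mono[OF shi vb(1)[OF i]] a q by (simp add: mult.commute)
      then have 1: "a \<le> sqrt (real N) * v i / ?q" using q by (simp add: pos_le_divide_eq)
      have "sqrt (real N) * v i \<le> sqrt (real N)" using vb(2)[OF i] sN by simp
      also have "\<dots> \<le> inverse a * ?q" using slo a by (simp add: field_simps)
      finally have 2: "sqrt (real N) * v i / ?q \<le> inverse a" using q by (simp add: pos_divide_le_eq)
      show ?thesis using 1 2 a i by (simp add: radial_proj_def abs_less_iff)
    qed
    moreover have "v \<in> punctured_ball N" using v pos hi by (auto simp: punctured_ball_def PiE_iff)
    ultimately show "v \<in> cone_ball N (A n)"
      using radial_proj_in_kac_sphere by (auto simp: cone_ball_def A_def d_def)
  qed
  then have le: "emeasure ?L ({..<N} \<rightarrow>\<^sub>E {a..1}) \<le> emeasure ?L (cone_ball N (A n))"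
    by (rule emeasure_mono) (rule cone_ball_sets[OF A_sets])
  have "emeasure ?L ({..<N} \<rightarrow>\<^sub>E {a..1}) = (\<Prod>i<N. emeasure lborel {a..1})"
    by (rule L.emeasure_PiM) auto
  also have "\<dots> = ennreal ((1 - a) ^ N)" using a by (simp add: ennreal_power)
  also have "\<dots> > 0" using a by simp
  finally have "emeasure ?K (A n) \<noteq> 0"
    using le emeasure_kac_uniform_eq_0_iff[OF N1 A_sets, of n] by auto
  then have "0 < measure ?K (A n)"
    by (simp add: K.emeasure_eq_measure zero_less_measure_iff)
  then show ?thesis using that[of "A n"] n sym by auto
qed

section \<open>Entropy bounds\<close>

lemma is_density_integral:
  assumes "is_density M f"
  shows "integrable M f" "(\<integral>x. f x \<partial>M) = 1" "f \<in> borel_measurable M" "\<And>x. x \<in> space M \<Longrightarrow> 0 \<le> f x"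
proof -
  show m: "f \<in> borel_measurable M" and nn: "\<And>x. x \<in> space M \<Longrightarrow> 0 \<le> f x"
    using assms by (auto simp: is_density_def)
  then have nn': "AE x in M. 0 \<le> f x" by auto
  have 1: "(\<integral>\<^sup>+x. ennreal (f x) \<partial>M) = ennreal 1" using assms by (simp add: is_density_def)
  show "integrable M f" by (rule integrableI_nn_integral_finite[OF m nn' 1])
  show "(\<integral>x. f x \<partial>M) = 1" using integral_eq_nn_integral[OF m nn'] 1 by simp
qed

lemma is_density_convex:
  assumes G: "is_density M G" and W: "is_density M W" and t: "0 \<le> t" "t \<le> (1::real)"
  shows "is_density M (\<lambda>x. (1 - t) * G x + t * W x)"
  unfolding is_density_def
proof (intro conjI ballI)
  note G' = is_density_integral[OF G] and W' = is_density_integral[OF W]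
  show "(\<lambda>x. (1 - t) * G x + t * W x) \<in> borel_measurable M" using G'(3) W'(3) by measurable
  show nn: "0 \<le> (1 - t) * G x + t * W x" if "x \<in> space M" for x
    using G'(4) W'(4) that t by simp
  have "(\<integral>\<^sup>+x. ennreal ((1 - t) * G x + t * W x) \<partial>M) = ennreal (\<integral>x. (1 - t) * G x + t * W x \<partial>M)"
    using G'(1) W'(1) nn by (intro nn_integral_eq_integral) auto
  also have "(\<integral>x. (1 - t) * G x + t * W x \<partial>M) = 1" using G' W' by simp
  finally show "(\<integral>\<^sup>+x. ennreal ((1 - t) * G x + t * W x) \<partial>M) = 1" by simp
qed

text \<open>The difference is \<open>t\<close> times the difference of the integrals of
  \<open>h\<close> against \<open>W\<close> and \<open>G\<close>, each of absolute value at most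
  \<open>B\<close>. A component of vanishing weight is therefore invisible to weak limits, however
  concentrated it is.\<close>

lemma convex_density_integral_diff:
  assumes G: "is_density M G" and W: "is_density M W" and t: "0 \<le> t"
    and h: "h \<in> borel_measurable M" "\<And>x. \<bar>h x\<bar> \<le> (B::real)"
  shows "\<bar>(\<integral>x. ((1 - t) * G x + t * W x) * h x \<partial>M) - (\<integral>x. G x * h x \<partial>M)\<bar> \<le> 2 * B * t"
proof -
  note G' = is_density_integral[OF G] and W' = is_density_integral[OF W]
  have *: "integrable M (\<lambda>x. D x * h x) \<and> \<bar>\<integral>x. D x * h x \<partial>M\<bar> \<le> B" if D: "is_density M D" for D
  proof -
    note D' = is_density_integral[OF D]
    have le: "norm (D x * h x) \<le> B * D x" if "x \<in> space M" for x
      using mult_right_mono[OF h(2)[of x] D'(4)[OF that]] D'(4)[OF that] by (simp add: abs_mult mult.commute)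
    have int: "integrable M (\<lambda>x. D x * h x)"
    proof (rule Bochner_Integration.integrable_bound[where f="\<lambda>x. B * D x"])
      show "AE x in M. norm (D x * h x) \<le> norm (B * D x)"
        using AE_space
      proof eventually_elim
        case (elim x)
        show ?case using le[OF elim] abs_ge_self[of "B * D x"] unfolding real_norm_def by linarith
      qed
    qed (use D' h(1) in auto)
    have "\<bar>\<integral>x. D x * h x \<partial>M\<bar> \<le> (\<integral>x. norm (D x * h x) \<partial>M)"
      using integral_norm_bound[of M "\<lambda>x. D x * h x"] by simp
    also have "\<dots> \<le> (\<integral>x. B * D x \<partial>M)"
      using int D' le by (intro integral_mono) auto
    finally have "\<bar>\<integral>x. D x * h x \<partial>M\<bar> \<le> (\<integral>x. B * D x \<partial>M)" .
    then show ?thesis using int D' by simp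
  qed
  have "(\<integral>x. ((1 - t) * G x + t * W x) * h x \<partial>M) = (\<integral>x. (1 - t) * (G x * h x) + t * (W x * h x) \<partial>M)"
    by (simp add: algebra_simps)
  also have "\<dots> = (1 - t) * (\<integral>x. G x * h x \<partial>M) + t * (\<integral>x. W x * h x \<partial>M)"
    using *[OF G] *[OF W] by simp
  finally have "(\<integral>x. ((1 - t) * G x + t * W x) * h x \<partial>M) - (\<integral>x. G x * h x \<partial>M)
      = t * ((\<integral>x. W x * h x \<partial>M) - (\<integral>x. G x * h x \<partial>M))"
    by (simp add: algebra_simps)
  moreover have "\<bar>(\<integral>x. W x * h x \<partial>M) - (\<integral>x. G x * h x \<partial>M)\<bar> \<le> 2 * B"
    using *[OF G] *[OF W] by linarith
  ultimately show ?thesis using t by (simp add: abs_mult mult_left_mono mult.commute)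
qed

text \<open>The positive part is at least \<open>t * ln t\<close> on \<open>A\<close>, as
  \<open>y * ln y\<close> increases for \<open>y \<ge> 1\<close>. The subtracted 1 bounds the whole
  negative part: \<open>- y * ln y \<le> 1\<close> for \<open>y \<ge> 0\<close>, and the total mass
  is 1.\<close>

lemma ext_integral_entropy_lower:
  assumes "prob_space M" and F: "is_density M F" and A: "A \<in> sets M"
    and t: "t \<ge> 1" "\<And>x. x \<in> A \<Longrightarrow> t \<le> F x"
  shows "ereal (t * ln t * measure M A - 1) \<le> ext_integral M (\<lambda>x. F x * ln (F x))"
proof -
  interpret prob_space M by fact
  note [measurable] = A is_density_integral(3)[OF F]
  have "ennreal (t * ln t * measure M A) = (\<integral>\<^sup>+x. ennreal (t * ln t) * indicator A x \<partial>M)"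
    using t A by (simp add: nn_integral_cmult emeasure_eq_measure ennreal_mult)
  also have "\<dots> \<le> (\<integral>\<^sup>+x. ennreal (F x * ln (F x)) \<partial>M)"
  proof (intro nn_integral_mono)
    fix x
    show "ennreal (t * ln t) * indicator A x \<le> ennreal (F x * ln (F x))"
    proof (cases "x \<in> A")
      case True
      then have "t * ln t \<le> F x * ln (F x)"
        using t(1) t(2)[OF True] by (intro mult_mono) auto
      then show ?thesis using True by (simp add: ennreal_leI)
    qed simp
  qed
  finally have "ereal (t * ln t * measure M A) \<le> enn2ereal (\<integral>\<^sup>+x. ennreal (F x * ln (F x)) \<partial>M)"
    using t by (simp add: less_eq_ennreal.rep_eq enn2ereal_ennreal)
  moreover have "(\<integral>\<^sup>+x. ennreal (- (F x * ln (F x))) \<partial>M) \<le> (\<integral>\<^sup>+x. 1 \<partial>M)"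
  proof (intro nn_integral_mono)
    fix x assume "x \<in> space M"
    then have "0 \<le> F x" by (rule is_density_integral(4)[OF F])
    have "- (F x * ln (F x)) \<le> 1"
    proof (cases "F x = 0")
      case False
      with \<open>0 \<le> F x\<close> have pos: "0 < F x" by simp
      have "ln (inverse (F x)) \<le> inverse (F x) - 1" using pos by (intro ln_le_minus_one) simp
      then have "F x * (- ln (F x)) \<le> F x * (inverse (F x) - 1)"
        using pos by (intro mult_left_mono) (auto simp: ln_inverse)
      also have "\<dots> \<le> 1" using pos by (simp add: right_diff_distrib)
      finally show ?thesis by simp
    qed simp
    then show "ennreal (- (F x * ln (F x))) \<le> 1" by (simp add: ennreal_le_1)
  qed
  then have "enn2ereal (\<integral>\<^sup>+x. ennreal (- (F x * ln (F x))) \<partial>M) \<le> 1"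
    by (simp add: emeasure_space_1 less_eq_ennreal.rep_eq one_ennreal.rep_eq)
  ultimately have "ereal (t * ln t * measure M A) - 1 \<le> ext_integral M (\<lambda>x. F x * ln (F x))"
    unfolding ext_integral_def by (rule ereal_minus_mono)
  then show ?thesis by (simp add: one_ereal_def)
qed

text \<open>The Gaussian turns the integrand into \<open>f * ln f\<close> plus a second moment term
  and a multiple of \<open>f\<close>, and \<open>f * ln f\<close> is dominated by
  \<open>f powr p / (p - 1)\<close>. A bound from above suffices for the claim, since the negative
  part only lowers the value.\<close>

lemma relative_entropy_gaussian_finite:
  fixes f :: "real \<Rightarrow> real"
  assumes f: "is_density lborel f" and p: "p > 1" and fp: "integrable lborel (\<lambda>x. \<bar>f x\<bar> powr p)"
    and m2: "integrable lborel (\<lambda>x. x\<^sup>2 * f x)"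
  shows "relative_entropy_gaussian f \<noteq> \<infinity>"
proof -
  note f' = is_density_integral[OF f]
  define b where "b x = \<bar>f x\<bar> powr p / (p - 1) + x\<^sup>2 * f x / 2 + \<bar>ln (sqrt (2 * pi))\<bar> * f x" for x
  have nn: "0 \<le> f x" for x using f'(4) by simp
  have b_int: "integrable lborel b"
    unfolding b_def[abs_def] using fp m2 f'(1) by auto
  have b_nn: "0 \<le> b x" for x using nn[of x] p by (simp add: b_def)
  have le: "f x * ln (f x / std_normal_density x) \<le> b x" for x
  proof (cases "f x = 0")
    case False
    with nn[of x] have pos: "0 < f x" by simp
    have "ln (f x / std_normal_density x) = ln (f x) + x\<^sup>2 / 2 + ln (sqrt (2 * pi))"
      using pos by (simp add: std_normal_density_def ln_div ln_mult)
    then have eq: "f x * ln (f x / std_normal_density x) = f x * ln (f x) + x\<^sup>2 * f x / 2 + ln (sqrt (2 * pi)) * f x"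
      by (simp add: algebra_simps)
    \<comment> \<open>The inequality \<open>ln z \<le> z\<close> at
      \<open>z = f x powr (p - 1)\<close> is what trades the logarithm for the power
      \<open>p\<close>.\<close>
    have "(p - 1) * ln (f x) = ln (f x powr (p - 1))" using pos by (simp add: ln_powr)
    also have "\<dots> \<le> f x powr (p - 1)" using pos ln_le_minus_one[of "f x powr (p - 1)"] by simp
    finally have "ln (f x) \<le> f x powr (p - 1) / (p - 1)" using p by (simp add: pos_le_divide_eq mult.commute)
    then have "f x * ln (f x) \<le> f x * (f x powr (p - 1) / (p - 1))" using pos by (intro mult_left_mono) auto
    also have "\<dots> = \<bar>f x\<bar> powr p / (p - 1)" using pos by (simp add: powr_diff)
    finally have "f x * ln (f x) \<le> \<bar>f x\<bar> powr p / (p - 1)" .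
    moreover have "ln (sqrt (2 * pi)) * f x \<le> \<bar>ln (sqrt (2 * pi))\<bar> * f x" using pos by (intro mult_right_mono) auto
    ultimately show ?thesis unfolding eq b_def by linarith
  qed (simp add: b_nn)
  have "(\<integral>\<^sup>+x. ennreal (f x * ln (f x / std_normal_density x)) \<partial>lborel) \<le> (\<integral>\<^sup>+x. ennreal (b x) \<partial>lborel)"
    by (intro nn_integral_mono ennreal_leI le)
  also have "\<dots> < \<infinity>"
    using nn_integral_eq_integral[OF b_int] b_nn by simp
  finally have "enn2ereal (\<integral>\<^sup>+x. ennreal (f x * ln (f x / std_normal_density x)) \<partial>lborel) \<noteq> \<infinity>"
    by (auto simp: enn2ereal_eq_top_iff)
  moreover have "0 \<le> enn2ereal (\<integral>\<^sup>+x. ennreal (- (f x * ln (f x / std_normal_density x))) \<partial>lborel)"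
    by (rule enn2ereal_nonneg)
  ultimately show ?thesis
    unfolding relative_entropy_gaussian_def ext_integral_def
    by (auto simp: ereal_minus_eq_PInfty_iff)
qed

text \<open>The properties required of one member of the family. The spike has weight
  \<open>1 / N\<close>, which gives the error \<open>2 * B / N\<close> in every bounded test, while
  its height is exponential in \<open>N ^ 3\<close>, which gives an entropy of order
  \<open>N ^ 2\<close>.\<close>

lemma exists_high_entropy_density:
  assumes f: "is_density lborel f" and N: "N \<ge> 1"
  shows "\<exists>F. is_density (kac_uniform N) F \<and> symmetric_on_sphere N F \<and>
    (\<forall>h B. h \<in> borel_measurable (kac_uniform N) \<longrightarrow> (\<forall>v. \<bar>h v\<bar> \<le> B) \<longrightarrow>
      \<bar>(\<integral>v. F v * h v \<partial>kac_uniform N) - (\<integral>v. h v \<partial>sphere_law (density lborel (\<lambda>x. ennreal (f x))) N)\<bar> \<le> 2 * B / real N) \<and>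
    (N \<ge> 2 \<longrightarrow> ereal ((real N)\<^sup>2 - 1) \<le> sphere_entropy N F)"
proof -
  let ?K = "kac_uniform N" and ?Q = "sphere_law (density lborel (\<lambda>x. ennreal (f x))) N"
  interpret K: prob_space ?K by (rule prob_space_kac_uniform[OF N])
  obtain G where G: "is_density ?K G" "symmetric_on_sphere N G" "density ?K (\<lambda>v. ennreal (G v)) = ?Q"
    using sphere_law_density[OF f N] by blast
  note G' = is_density_integral[OF G(1)]
  have G_int: "(\<integral>v. h v \<partial>?Q) = (\<integral>v. G v * h v \<partial>?K)" if "h \<in> borel_measurable ?K" for h :: "_ \<Rightarrow> real"
    unfolding G(3)[symmetric] using that G' by (subst integral_density) auto
  show ?thesis
  proof (cases "N \<ge> 2")
    case False
    \<comment> \<open>For \<open>N = 1\<close> no spike is added and \<open>F\<close> is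
      \<open>G\<close>; the test estimate then only asks that \<open>B\<close> be
      nonnegative.\<close>
    have "0 \<le> B" if "\<forall>v. \<bar>h v\<bar> \<le> B" for h :: "(nat \<Rightarrow> real) \<Rightarrow> real" and B :: real
      using that abs_ge_zero order_trans by blast
    then show ?thesis using G G_int False by (intro exI[of _ G]) auto
  next
    case N2: True
    \<comment> \<open>The factor \<open>1 / N\<close> cancels the weight of the spike, so its height
      in the mixture is at least \<open>exp (N ^ 3)\<close>. The exponent 3 leaves
      \<open>N ^ 2\<close>, still superlinear, after multiplication of the logarithm by the
      weight.\<close>
    define e where "e = exp (- (real N ^ 3)) / real N"
    have e: "e > 0" using N by (simp add: e_def)
    obtain A where A: "A \<in> sets ?K" "0 < measure ?K A" "measure ?K A \<le> e"
      "\<And>\<pi> v. \<pi> permutes {..<N} \<Longrightarrow> v \<in> kac_sphere N \<Longrightarrow> v \<circ> \<pi> \<in> A \<longleftrightarrow> v \<in> A"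
      using exists_small_symmetric_set[OF N2 e] by blast
    let ?m = "measure ?K A"
    define W where "W v = indicator A v / ?m" for v
    have W: "is_density ?K W"
    proof -
      have "(\<integral>\<^sup>+v. ennreal (W v) \<partial>?K) = (\<integral>\<^sup>+v. ennreal (1 / ?m) * indicator A v \<partial>?K)"
        unfolding W_def by (intro nn_integral_cong) (auto simp: indicator_def)
      also have "\<dots> = ennreal (1 / ?m) * ennreal ?m"
        using A(1) by (simp add: nn_integral_cmult K.emeasure_eq_measure)
      also have "\<dots> = 1" using A(2) by (simp add: ennreal_mult[symmetric])
      finally show ?thesis using A(1) unfolding is_density_def W_def by auto
    qed
    have W_sym: "symmetric_on_sphere N W"
      using A(4) by (simp add: symmetric_on_sphere_def W_def indicator_def)
    define t where "t = 1 / real N"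
    have t: "0 \<le> t" "t \<le> 1" using N by (auto simp: t_def)
    define F where "F v = (1 - t) * G v + t * W v" for v
    have F: "is_density ?K F"
      using is_density_convex[OF G(1) W t] by (simp add: F_def[abs_def])
    have F_sym: "symmetric_on_sphere N F"
      using G(2) W_sym by (simp add: symmetric_on_sphere_def F_def)
    \<comment> \<open>The height that the spike adds over \<open>A\<close>; since the other
      component is nonnegative, it bounds \<open>F\<close> from below there.\<close>
    define s where "s = t / ?m"
    have s_ge: "exp (real N ^ 3) \<le> s"
    proof -
      have "exp (real N ^ 3) * ?m \<le> exp (real N ^ 3) * e" using A(3) by simp
      also have "\<dots> = t" by (simp add: e_def t_def exp_minus)
      finally show ?thesis using A(2) by (simp add: s_def pos_le_divide_eq)
    qed
    have "1 \<le> exp (real N ^ 3)" by simp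
    then have s1: "1 \<le> s" using s_ge by linarith
    have "s \<le> F v" if "v \<in> A" for v
    proof -
      have "v \<in> space ?K" using sets.sets_into_space[OF A(1)] that by blast
      then have "0 \<le> (1 - t) * G v" using G'(4) t by simp
      then show ?thesis using that by (simp add: F_def W_def s_def)
    qed
    from ext_integral_entropy_lower[OF K.prob_space_axioms F A(1) s1 this]
    have ent: "ereal (s * ln s * ?m - 1) \<le> sphere_entropy N F" by (simp add: sphere_entropy_def)
    \<comment> \<open>The spike carries mass \<open>s * ?m = t\<close>, so the lower bound
      \<open>s * ln s * ?m\<close> equals \<open>t * ln s\<close>, which is at least
      \<open>t * N ^ 3 = N ^ 2\<close>.\<close>
    have "real N ^ 3 \<le> ln s" using s_ge s1 by (simp add: ln_ge_iff)
    then have "t * real N ^ 3 \<le> t * ln s" using t by (intro mult_left_mono) auto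
    moreover have "s * ?m = t" using A(2) by (simp add: s_def)
    moreover have "t * real N ^ 3 = (real N)\<^sup>2" using N by (simp add: t_def power3_eq_cube power2_eq_square)
    ultimately have "(real N)\<^sup>2 \<le> s * ?m * ln s" by simp
    then have "ereal ((real N)\<^sup>2 - 1) \<le> ereal (s * ln s * ?m - 1)" by (simp add: mult_ac)
    then have "ereal ((real N)\<^sup>2 - 1) \<le> sphere_entropy N F" using ent by (rule order_trans)
    moreover have "\<bar>(\<integral>v. F v * h v \<partial>?K) - (\<integral>v. h v \<partial>?Q)\<bar> \<le> 2 * B / real N"
      if "h \<in> borel_measurable ?K" "\<forall>v. \<bar>h v\<bar> \<le> B" for h B
      using convex_density_integral_diff[OF G(1) W t(1) that(1), of B] that
      by (simp add: F_def G_int t_def)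
    ultimately show ?thesis using F F_sym by blast
  qed
qed

section \<open>Chaoticity of the family and divergence of its entropy per coordinate\<close>

theorem theorem1p6:
  fixes f :: "real \<Rightarrow> real" and p :: real
  assumes "is_density lborel f"
    and "p > 1" and "integrable lborel (\<lambda>x. \<bar>f x\<bar> powr p)"
    and "has_bochner_integral lborel (\<lambda>x. x\<^sup>2 * f x) 1"
    and "integrable lborel (\<lambda>x. x ^ 4 * f x)"
  shows "\<exists>F :: nat \<Rightarrow> (nat \<Rightarrow> real) \<Rightarrow> real.
    symmetric_density_family F \<and> chaotic f F \<and> \<not> entropically_chaotic f F"
proof -
  note f = assms(1)
  let ?\<mu> = "density lborel (\<lambda>x. ennreal (f x))"
  have f_meas[measurable]: "f \<in> borel_measurable borel" and f_nn: "\<And>x. 0 \<le> f x"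
    using is_density_integral(3,4)[OF f] by auto
  obtain F where F: "\<And>N. N \<ge> 1 \<Longrightarrow> is_density (kac_uniform N) (F N)" "\<And>N. N \<ge> 1 \<Longrightarrow> symmetric_on_sphere N (F N)"
    and F_int: "\<And>N h B. N \<ge> 1 \<Longrightarrow> h \<in> borel_measurable (kac_uniform N) \<Longrightarrow> (\<And>v. \<bar>h v\<bar> \<le> B) \<Longrightarrow>
      \<bar>(\<integral>v. F N v * h v \<partial>kac_uniform N) - (\<integral>v. h v \<partial>sphere_law ?\<mu> N)\<bar> \<le> 2 * B / real N"
    and F_ent: "\<And>N. N \<ge> 2 \<Longrightarrow> ereal ((real N)\<^sup>2 - 1) \<le> sphere_entropy N (F N)"
  proof -
    have "\<forall>N. \<exists>F. N \<ge> 1 \<longrightarrow> is_density (kac_uniform N) F \<and> symmetric_on_sphere N F \<and>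
      (\<forall>h B. h \<in> borel_measurable (kac_uniform N) \<longrightarrow> (\<forall>v. \<bar>h v\<bar> \<le> B) \<longrightarrow>
        \<bar>(\<integral>v. F v * h v \<partial>kac_uniform N) - (\<integral>v. h v \<partial>sphere_law ?\<mu> N)\<bar> \<le> 2 * B / real N) \<and>
      (N \<ge> 2 \<longrightarrow> ereal ((real N)\<^sup>2 - 1) \<le> sphere_entropy N F)"
      using exists_high_entropy_density[OF f] by blast
    from choice[OF this] obtain F where F: "\<And>N. N \<ge> 1 \<Longrightarrow> is_density (kac_uniform N) (F N) \<and> symmetric_on_sphere N (F N) \<and>
      (\<forall>h B. h \<in> borel_measurable (kac_uniform N) \<longrightarrow> (\<forall>v. \<bar>h v\<bar> \<le> B) \<longrightarrow>
        \<bar>(\<integral>v. F N v * h v \<partial>kac_uniform N) - (\<integral>v. h v \<partial>sphere_law ?\<mu> N)\<bar> \<le> 2 * B / real N) \<and>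
      (N \<ge> 2 \<longrightarrow> ereal ((real N)\<^sup>2 - 1) \<le> sphere_entropy N (F N))" by blast
    show ?thesis
    proof (rule that[of F])
      show "ereal ((real N)\<^sup>2 - 1) \<le> sphere_entropy N (F N)" if "N \<ge> 2" for N
        using F[of N] that by simp
    qed (use F in blast)+
  qed
  have "symmetric_density_family F"
    using F by (simp add: symmetric_density_family_def)
  moreover have "chaotic f F"
    unfolding chaotic_def
  proof (intro allI impI)
    fix k :: nat and \<phi>
    assume \<phi>: "continuous_map (powertop_real {..<k}) euclideanreal \<phi>" and bdd: "bounded (\<phi> ` ({..<k} \<rightarrow>\<^sub>E UNIV))"
    have m2: "integrable ?\<mu> (\<lambda>x. x\<^sup>2)" "(\<integral>x. x\<^sup>2 \<partial>?\<mu>) = 1"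
      using assms(4) f_nn
      by (simp_all add: integrable_density integral_density has_bochner_integral_iff mult.commute)
    have m4: "integrable ?\<mu> (\<lambda>x. x ^ 4)"
      using assms(5) f_nn by (simp add: integrable_density mult.commute)
    have "(\<lambda>N. \<integral>v. \<phi> (restrict v {..<k}) \<partial>sphere_law ?\<mu> N) \<longlonglongrightarrow> (\<integral>x. \<phi> x \<partial>(\<Pi>\<^sub>M i\<in>{..<k}. ?\<mu>))"
      by (rule sphere_law_tendsto[OF prob_space_density_lborel[OF f] _ m2 m4 \<phi> bdd]) simp
    moreover have "(\<integral>x. \<phi> x \<partial>(\<Pi>\<^sub>M i\<in>{..<k}. ?\<mu>)) = (\<integral>x. (\<Prod>i<k. f (x i)) * \<phi> x \<partial>(\<Pi>\<^sub>M i\<in>{..<k}. lborel))"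
    proof -
      have "\<phi> \<in> borel_measurable (\<Pi>\<^sub>M i\<in>{..<k}. lborel)"
        using borel_measurable_continuous_map_PiM(2)[OF \<phi>]
        by (simp cong: measurable_cong_sets sets_PiM_cong)
      then show ?thesis
        unfolding PiM_density_lborel[OF f finite_lessThan]
        using f_nn by (subst integral_density) (auto intro!: prod_nonneg)
    qed
    moreover obtain B where B: "\<And>v. \<bar>\<phi> (restrict v {..<k})\<bar> \<le> B"
    proof -
      obtain B where "\<And>y. y \<in> \<phi> ` ({..<k} \<rightarrow>\<^sub>E UNIV) \<Longrightarrow> \<bar>y\<bar> \<le> B"
        using bdd by (auto simp: bounded_iff)
      then show ?thesis by (intro that[of B]) auto
    qed
    \<comment> \<open>The spike changes the integral of a test function bounded by \<open>B\<close>
      by at most \<open>2 * B / N\<close>, so the limit is that of the projected product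
      laws.\<close>
    moreover have "(\<lambda>N. (\<integral>v. F N v * \<phi> (restrict v {..<k}) \<partial>kac_uniform N) - (\<integral>v. \<phi> (restrict v {..<k}) \<partial>sphere_law ?\<mu> N)) \<longlonglongrightarrow> 0"
    proof (rule Lim_null_comparison)
      show "\<forall>\<^sub>F N in sequentially. norm ((\<integral>v. F N v * \<phi> (restrict v {..<k}) \<partial>kac_uniform N) -
          (\<integral>v. \<phi> (restrict v {..<k}) \<partial>sphere_law ?\<mu> N)) \<le> 2 * B / real N"
        using eventually_ge_at_top[of k] eventually_ge_at_top[of 1]
      proof eventually_elim
        case (elim N)
        then show ?case
          using F_int[OF _ borel_measurable_restrict_kac_uniform[OF \<phi>] B] by simp
      qed
      show "(\<lambda>N. 2 * B / real N) \<longlonglongrightarrow> 0" by (rule lim_const_over_n)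
    qed
    ultimately show "(\<lambda>N. \<integral>v. F N v * \<phi> (restrict v {..<k}) \<partial>kac_uniform N) \<longlonglongrightarrow>
        (\<integral>x. (\<Prod>i<k. f (x i)) * \<phi> x \<partial>(\<Pi>\<^sub>M i\<in>{..<k}. lborel))"
      using tendsto_add[of _ 0 sequentially "\<lambda>N. \<integral>v. \<phi> (restrict v {..<k}) \<partial>sphere_law ?\<mu> N"] by fastforce
  qed
  moreover have "\<not> entropically_chaotic f F"
  proof
    assume "entropically_chaotic f F"
    then have lim: "(\<lambda>N. sphere_entropy N (F N) / ereal (real N)) \<longlonglongrightarrow> relative_entropy_gaussian f"
      by (simp add: entropically_chaotic_def)
    have "(\<lambda>N. sphere_entropy N (F N) / ereal (real N)) \<longlonglongrightarrow> \<infinity>"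
      unfolding tendsto_PInfty
    proof
      fix r :: real
      \<comment> \<open>For \<open>N \<ge> n\<close> and \<open>N \<ge> 2\<close> the entropy per
        coordinate is at least \<open>(N^2 - 1) / N = N - 1 / N\<close>, hence at least
        \<open>N - 1 > r\<close>.\<close>
      obtain n where n: "r + 1 < real n" using reals_Archimedean2 by blast
      show "\<forall>\<^sub>F N in sequentially. ereal r < sphere_entropy N (F N) / ereal (real N)"
        using eventually_ge_at_top[of n] eventually_ge_at_top[of 2]
      proof eventually_elim
        case (elim N)
        have "1 / real N \<le> 1" using elim by simp
        then have "r < real N - 1 / real N" using n elim by linarith
        also have "\<dots> = ((real N)\<^sup>2 - 1) / real N" using elim by (simp add: field_simps power2_eq_square)
        finally have "ereal r < ereal ((real N)\<^sup>2 - 1) / ereal (real N)" using elim by simp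
        also have "\<dots> \<le> sphere_entropy N (F N) / ereal (real N)"
          using F_ent[of N] elim by (intro ereal_divide_right_mono) auto
        finally show ?case .
      qed
    qed
    \<comment> \<open>Entropic chaos would force the limit of the entropy per coordinate to be the
      relative entropy, which is not infinite.\<close>
    then have "relative_entropy_gaussian f = \<infinity>" using lim LIMSEQ_unique by blast
    moreover have "relative_entropy_gaussian f \<noteq> \<infinity>"
      using relative_entropy_gaussian_finite[OF f assms(2,3)] assms(4) by (simp add: has_bochner_integral_iff)
    ultimately show False by contradiction
  qed
  ultimately show ?thesis by blast
qed

end
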